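(* Let $c_1(x),c_2(x),f_1(x),f_2(x)\in\mathbb{Q}[x]$ be non-zero polynomials. For a positive integer $n$ define $u_n(x)=c_1(x)f_1(x)^n+c_2(x)f_2(x)^n$. Then the following two conditions are equivalent. (1) There exist infinitely many roots of unity $\zeta\in\mathbb{C}$ such that for some positive integer $n$ the polynomial $u_n(x)$ is not identically zero but $u_n(\zeta)=0$. (2) There exist $a,b\in\mathbb{Z}$ with $b\neq 0$ and $\delta,\varepsilon\in\{1,-1\}$ such that $$\frac{c_2(x)}{c_1(x)}=\delta x^a,\qquad \frac{f_2(x)}{f_1(x)}=\varepsilon x^b$$ (equalities in the field $\mathbb{Q}(x)$ of rational functions). *)

theory Defs
  imports
    "HOL-Complex_Analysis.Complex_Analysis"
    "HOL-Computational_Algebra.Computational_Algebra"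
begin

definition root_of_unity :: "complex \<Rightarrow> bool" where
  "root_of_unity z \<longleftrightarrow> (\<exists>k::nat. k > 0 \<and> z ^ k = 1)"

definition u_poly ::
  "rat poly \<Rightarrow> rat poly \<Rightarrow> rat poly \<Rightarrow> rat poly \<Rightarrow> nat \<Rightarrow> rat poly" where
  "u_poly c1 c2 f1 f2 n = c1 * f1 ^ n + c2 * f2 ^ n"

abbreviation cpoly :: "rat poly \<Rightarrow> complex \<Rightarrow> complex" where
  "cpoly p z \<equiv> poly (map_poly of_rat p) z"

abbreviation rat_fun_X :: "rat poly fract" where
  "rat_fun_X \<equiv> to_fract [:0, 1:]"

end

theory Submission
  imports Defs
begin

text \<open>
  The idea is the Amoroso--Dvornicich lower bound for heights in cyclotomic fields. Suppose
  \<open>c\<^sub>1 f\<^sub>1\<^sup>n + c\<^sub>2 f\<^sub>2\<^sup>n\<close> vanishes at a root of unity \<open>\<zeta>\<close> of order \<open>m\<close>. For a fixed \<open>n\<close> this happens only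
  finitely often unless the polynomial is zero, so \<open>n\<close> may be taken large, and then
  \<open>\<alpha> = f\<^sub>2(\<zeta>)/f\<^sub>1(\<zeta>)\<close> has tiny height. Fix a large prime \<open>p\<close>. If \<open>p\<close> does not divide \<open>m\<close>, let \<open>\<sigma>\<close> be the
  automorphism raising \<open>\<zeta>\<close> to the power \<open>p\<close>, so that \<open>\<alpha>\<^sup>p\<close> and \<open>\<sigma>\<alpha>\<close> are congruent modulo \<open>p\<close>; if \<open>p\<close> divides \<open>m\<close>,
  let \<open>\<sigma>\<close> multiply \<open>\<zeta>\<close> by a primitive \<open>p\<close>-th root of unity, so that \<open>\<alpha>\<^sup>p\<close> and \<open>(\<sigma>\<alpha>)\<^sup>p\<close> are congruent.
  In either case the small height turns the congruence into an equality, which for infinitely many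
  \<open>\<zeta>\<close> becomes an identity of rational functions, and since \<open>p\<close> exceeds all degrees
  it makes \<open>f\<^sub>2/f\<^sub>1\<close> a monomial, with coefficient \<open>\<plusminus>1\<close> because \<open>n\<close> is unbounded. Then \<open>c\<^sub>2/c\<^sub>1\<close> takes roots of unity as
  values at infinitely many roots of unity, and the same argument applies to it.

  The denominators must be invertible modulo \<open>p\<close>; for two different primes this can fail
  simultaneously only for finitely many \<open>\<zeta>\<close>.
\<close>

subsection \<open>Evaluating integer polynomials at complex numbers\<close>

definition ev :: "int poly \<Rightarrow> complex \<Rightarrow> complex" where
  "ev P z = poly (map_poly of_int P) z"

lemma ev_0 [simp]: "ev 0 z = 0"
  by (simp add: ev_def)

lemma ev_pCons [simp]: "ev (pCons a P) z = of_int a + z * ev P z"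
  by (simp add: ev_def map_poly_pCons)

lemma ev_1 [simp]: "ev 1 z = 1"
  by (simp add: ev_def)

lemma ev_add [simp]: "ev (P + Q) z = ev P z + ev Q z"
  by (induction P Q rule: poly_induct2) (auto simp: algebra_simps)

lemma ev_smult [simp]: "ev (smult a P) z = of_int a * ev P z"
  by (induction P) (auto simp: algebra_simps)

lemma ev_uminus [simp]: "ev (- P) z = - ev P z"
  by (induction P) (auto simp: algebra_simps)

lemma ev_diff [simp]: "ev (P - Q) z = ev P z - ev Q z"
  using ev_add[of P "- Q" z] by simp

lemma ev_mult [simp]: "ev (P * Q) z = ev P z * ev Q z"
  by (induction P) (auto simp: algebra_simps)

lemma ev_power [simp]: "ev (P ^ n) z = ev P z ^ n"
  by (induction n) auto

lemma ev_of_int [simp]: "ev (of_int n) z = of_int n"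
  by (simp add: of_int_poly)

lemma ev_of_nat [simp]: "ev (of_nat n) z = of_nat n"
  using ev_of_int[of "int n" z] by simp

lemma ev_sum [simp]: "ev (sum F X) z = (\<Sum>x\<in>X. ev (F x) z)"
  by (induction X rule: infinite_finite_induct) auto

lemma ev_monom [simp]: "ev (monom a n) z = of_int a * z ^ n"
  by (simp add: ev_def map_poly_monom poly_monom)

lemma ev_pcompose [simp]: "ev (pcompose P Q) z = ev P (ev Q z)"
  by (induction P) (auto simp: pcompose_pCons algebra_simps)

lemma ev_altdef: "ev P z = (\<Sum>i\<le>degree P. of_int (coeff P i) * z ^ i)"
  by (simp add: ev_def poly_altdef coeff_map_poly degree_map_poly)

lemma finite_ev_roots:
  assumes "P \<noteq> 0"
  shows "finite {z. ev P z = 0}"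
proof -
  have "map_poly of_int P \<noteq> (0 :: complex poly)"
    using assms by (simp add: map_poly_eq_0_iff)
  thus ?thesis
    unfolding ev_def by (rule poly_roots_finite)
qed

lemma ev_cnj: "cnj (ev P z) = ev P (cnj z)"
  by (induction P) auto

lemma ev_bounded_unit_circle:
  obtains M where "M \<ge> 1" "\<And>z. norm z = 1 \<Longrightarrow> norm (ev P z) \<le> M"
proof
  \<comment> \<open>The summand 1 secures \<open>M \<ge> 1\<close>, so that powers of
    \<open>M\<close> can later be compared by their exponents.\<close>
  show "1 + (\<Sum>i\<le>degree P. \<bar>real_of_int (coeff P i)\<bar>) \<ge> 1"
    by (simp add: sum_nonneg)
next
  fix z :: complex assume z: "norm z = 1"
  have "norm (ev P z) \<le> (\<Sum>i\<le>degree P. norm (of_int (coeff P i) * z ^ i))"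
    unfolding ev_altdef by (rule norm_sum)
  also have "\<dots> = (\<Sum>i\<le>degree P. \<bar>real_of_int (coeff P i)\<bar>)"
    by (simp add: norm_mult norm_power z)
  finally show "norm (ev P z) \<le> 1 + (\<Sum>i\<le>degree P. \<bar>real_of_int (coeff P i)\<bar>)"
    by simp
qed

subsection \<open>Primitive roots of unity\<close>

text \<open>For \<open>m = 0\<close> both conditions are vacuous and the set is the whole plane,
  hence the recurring hypothesis \<open>m > 0\<close>.\<close>

definition primroots :: "nat \<Rightarrow> complex set" where
  "primroots m = {z. z ^ m = 1 \<and> (\<forall>d. 0 < d \<and> d < m \<longrightarrow> z ^ d \<noteq> 1)}"

lemma primroots_power_eq_1_iff:
  assumes "z \<in> primroots m" "m > 0"
  shows "z ^ k = 1 \<longleftrightarrow> m dvd k"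
proof
  assume k: "z ^ k = 1"
  have "z ^ (k mod m) = 1"
  proof -
    have "z ^ k = z ^ (m * (k div m) + k mod m)" by simp
    also have "\<dots> = (z ^ m) ^ (k div m) * z ^ (k mod m)" by (simp only: power_add power_mult)
    also have "\<dots> = z ^ (k mod m)" using assms by (simp add: primroots_def)
    finally show ?thesis using k by simp
  qed
  moreover have "k mod m < m" using assms by simp
  ultimately have "k mod m = 0" using assms unfolding primroots_def by auto
  thus "m dvd k" by auto
next
  assume "m dvd k"
  thus "z ^ k = 1" using assms by (auto simp: primroots_def power_mult elim!: dvdE)
qed

lemma ex_primroots:
  fixes z :: complex
  assumes "z ^ k = 1" "k > 0"
  obtains m where "m > 0" "z \<in> primroots m" "m dvd k"
proof -
  define m where "m = (LEAST m. m > 0 \<and> z ^ m = 1)"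
  have m: "m > 0 \<and> z ^ m = 1" unfolding m_def by (rule LeastI[of _ k]) (use assms in auto)
  have "z \<in> primroots m"
    unfolding primroots_def using m not_less_Least[of _ "\<lambda>m. m > 0 \<and> z ^ m = 1", folded m_def] by auto
  with m primroots_power_eq_1_iff[OF this, of k] assms show ?thesis by (intro that[of m]) auto
qed

lemma primroots_unique:
  assumes "z \<in> primroots m" "z \<in> primroots d" "m > 0" "d > 0"
  shows "m = d"
  by (metis assms dvd_antisym dvd_refl primroots_power_eq_1_iff)

lemma primroots_norm: "z \<in> primroots m \<Longrightarrow> m > 0 \<Longrightarrow> norm z = 1"
  unfolding primroots_def using power_eq_1_iff[of z m] by auto

lemma primroots_nonzero: "z \<in> primroots m \<Longrightarrow> m > 0 \<Longrightarrow> z \<noteq> 0"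
  using primroots_norm by fastforce

lemma finite_primroots: "m > 0 \<Longrightarrow> finite (primroots m)"
  by (rule finite_subset[OF _ finite_roots_unity[of m]]) (auto simp: primroots_def)

lemma primroots_power:
  assumes "z \<in> primroots m" "m > 0" "coprime k m"
  shows "z ^ k \<in> primroots m"
proof -
  have "(z ^ k) ^ d = 1 \<longleftrightarrow> m dvd d" for d
    using primroots_power_eq_1_iff[OF assms(1,2), of "k * d"] assms(3)
    by (simp add: power_mult coprime_dvd_mult_right_iff coprime_commute)
  thus ?thesis unfolding primroots_def using assms(2) nat_dvd_not_less by auto
qed

lemma inj_on_primroot_powers:
  assumes "z \<in> primroots m" "m > 0"
  shows "inj_on (\<lambda>i. z ^ i) {..<m}"
proof -
  have *: False if "i < j" "j < m" "z ^ i = z ^ j" for i j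
  proof -
    have "z ^ j = z ^ i * z ^ (j - i)" using that by (subst power_add[symmetric]) simp
    hence "z ^ (j - i) = 1" using that primroots_nonzero[OF assms] by auto
    thus False using assms that by (auto simp: primroots_def)
  qed
  show ?thesis
    by (rule inj_onI) (metis * lessThan_iff nat_neq_iff)
qed

lemma roots_unity_eq_powers:
  assumes "z \<in> primroots m" "m > 0"
  shows "{w. w ^ m = 1} = (\<lambda>i. z ^ i) ` {..<m}"
proof (rule card_seteq[symmetric])
  show "finite {w :: complex. w ^ m = 1}" using finite_roots_unity[of m] assms by simp
  show "(\<lambda>i. z ^ i) ` {..<m} \<subseteq> {w. w ^ m = 1}"
  proof
    fix w assume "w \<in> (\<lambda>i. z ^ i) ` {..<m}"
    then obtain i where "w = z ^ i" by blast
    hence "w ^ m = (z ^ m) ^ i" by (simp add: mult.commute flip: power_mult)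
    thus "w \<in> {w. w ^ m = 1}" using assms by (simp add: primroots_def)
  qed
  show "card {w :: complex. w ^ m = 1} \<le> card ((\<lambda>i. z ^ i) ` {..<m})"
    using card_roots_unity[of m, where 'a = complex] inj_on_primroot_powers[OF assms] assms by (simp add: card_image)
qed

text \<open>The powers of \<open>z\<close> exhaust all \<open>m\<close>-th roots of unity, so
  \<open>z'\<close> is some \<open>z ^ k\<close>; a common factor \<open>g\<close> of
  \<open>k\<close> and \<open>m\<close> would give \<open>z'\<close> an order dividing
  \<open>m / g\<close>.\<close>

lemma primroots_conjugate:
  assumes "z \<in> primroots m" "z' \<in> primroots m" "m > 0"
  obtains k where "coprime k m" "z' = z ^ k"
proof -
  from roots_unity_eq_powers[OF assms(1,3)] assms(2) obtain k where k: "z' = z ^ k"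
    by (force simp: primroots_def)
  have "coprime k m"
  proof -
    define g where "g = gcd k m"
    have g: "g dvd k" "g dvd m" "g > 0" using assms by (auto simp: g_def)
    then obtain a b where ab: "k = g * a" "m = g * b" by (auto elim!: dvdE)
    have "z' ^ b = z ^ (m * a)" unfolding k ab by (simp add: mult_ac flip: power_mult)
    also have "\<dots> = 1" using assms by (simp add: power_mult primroots_def)
    finally have "m dvd b" using primroots_power_eq_1_iff[OF assms(2,3)] by simp
    hence "g = 1" using ab assms(3) by (auto elim!: dvdE)
    thus ?thesis by (simp add: g_def coprime_iff_gcd_eq_1)
  qed
  thus ?thesis using k that by blast
qed

lemma card_primroots_le:
  assumes "m > 0"
  shows "card (primroots m) \<le> m"
proof -
  have "card (primroots m) \<le> card {z::complex. z ^ m = 1}"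
    by (intro card_mono) (use finite_roots_unity[of m] assms in \<open>auto simp: primroots_def\<close>)
  thus ?thesis using card_roots_unity[of m, where 'a = complex] assms by simp
qed

section \<open>Traces over the primitive roots of unity\<close>

lemma sum_all_roots_unity_powers_Ints:
  assumes "m > 0"
  shows "(\<Sum>z | z ^ m = 1. z ^ i :: complex) \<in> \<int>"
proof (cases "\<forall>z::complex. z ^ m = 1 \<longrightarrow> z ^ i = 1")
  case True
  hence "(\<Sum>z | z ^ m = 1. z ^ i :: complex) = (\<Sum>z::complex | z ^ m = 1. 1)"
    by (intro sum.cong) auto
  thus ?thesis by simp
next
  case False
  \<comment> \<open>Multiplication by \<open>w\<close> permutes the \<open>m\<close>-th roots of
    unity and scales the sum by \<open>w ^ i \<noteq> 1\<close>, so the sum is 0.\<close>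
  then obtain w :: complex where w: "w ^ m = 1" "w ^ i \<noteq> 1" by blast
  have w0: "w \<noteq> 0" using w assms by (metis power_0_left zero_neq_one less_numeral_extra(3))
  have "(\<Sum>z | z ^ m = 1. z ^ i) = (\<Sum>z | z ^ m = 1. (w * z) ^ i)"
    by (rule sum.reindex_bij_witness[of _ "\<lambda>z. w * z" "\<lambda>z. z / w"])
       (use w w0 in \<open>auto simp: power_mult_distrib power_divide\<close>)
  also have "\<dots> = w ^ i * (\<Sum>z | z ^ m = 1. z ^ i)"
    by (simp add: power_mult_distrib sum_distrib_left)
  finally have "(\<Sum>z | z ^ m = 1. z ^ i :: complex) = 0" using w by simp
  thus ?thesis by simp
qed

text \<open>These are Ramanujan sums. Sorting all \<open>m\<close>-th roots of unity by exact order
  expresses the sum through the full one and those of proper divisors, which are integers by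
  induction.\<close>

lemma ramanujan_sum_Ints:
  "m > 0 \<Longrightarrow> (\<Sum>z\<in>primroots m. z ^ i) \<in> \<int>"
proof (induction m rule: less_induct)
  case (less m)
  have eq: "{z::complex. z ^ m = 1} = (\<Union>d\<in>{d. d dvd m}. primroots d)"
  proof (intro equalityI subsetI)
    fix z :: complex assume "z \<in> {z. z ^ m = 1}"
    then obtain d where "d > 0" "z \<in> primroots d" "d dvd m"
      using ex_primroots[of z m] less.prems by auto
    thus "z \<in> (\<Union>d\<in>{d. d dvd m}. primroots d)" by blast
  next
    fix z assume "z \<in> (\<Union>d\<in>{d. d dvd m}. primroots d)"
    thus "z \<in> {z. z ^ m = 1}" by (auto simp: primroots_def power_mult)
  qed
  have "(\<Sum>z | z ^ m = 1. z ^ i :: complex) = (\<Sum>d | d dvd m. \<Sum>z\<in>primroots d. z ^ i)"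
    unfolding eq
  proof (rule sum.UNION_disjoint)
    show "finite {d. d dvd m}" using less.prems by simp
    show "\<forall>d\<in>{d. d dvd m}. finite (primroots d)"
      using less.prems by (auto intro!: finite_primroots dvd_pos_nat[of m])
    show "\<forall>d\<in>{d. d dvd m}. \<forall>e\<in>{d. d dvd m}. d \<noteq> e \<longrightarrow> primroots d \<inter> primroots e = {}"
      using less.prems primroots_unique dvd_pos_nat by blast
  qed
  also have "\<dots> = (\<Sum>z\<in>primroots m. z ^ i) + (\<Sum>d\<in>{d. d dvd m} - {m}. \<Sum>z\<in>primroots d. z ^ i)"
    using less.prems by (intro sum.remove) auto
  finally have "(\<Sum>z\<in>primroots m. z ^ i) =
      (\<Sum>z | z ^ m = 1. z ^ i) - (\<Sum>d\<in>{d. d dvd m} - {m}. \<Sum>z\<in>primroots d. z ^ i)"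
    by simp
  also have "\<dots> \<in> \<int>"
    using less.prems
    by (intro Ints_diff sum_all_roots_unity_powers_Ints Ints_sum less.IH)
       (auto dest: dvd_imp_le dvd_pos_nat intro: le_neq_implies_less)
  finally show ?case .
qed

lemma trace_Ints:
  assumes "m > 0"
  shows "(\<Sum>z\<in>primroots m. ev P z) \<in> \<int>"
proof -
  have "(\<Sum>z\<in>primroots m. ev P z) = (\<Sum>i\<le>degree P. of_int (coeff P i) * (\<Sum>z\<in>primroots m. z ^ i))"
    unfolding ev_altdef by (subst sum.swap) (simp add: sum_distrib_left)
  also have "\<dots> \<in> \<int>" by (intro Ints_sum Ints_mult ramanujan_sum_Ints assms) auto
  finally show ?thesis .
qed

lemma primroots_cnj: 
  assumes "z \<in> primroots m" "m > 0"
  shows "cnj z = z ^ (m - 1)"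
proof -
  have "z * z ^ (m - 1) = 1" using assms by (simp add: primroots_def flip: power_Suc)
  moreover have "z * cnj z = 1" using primroots_norm[OF assms] by (simp flip: complex_norm_square)
  ultimately show ?thesis using primroots_nonzero[OF assms] by (metis mult_cancel_left)
qed

text \<open>Complex conjugation sends a primitive root \<open>z\<close> to
  \<open>z ^ (m - 1)\<close>, so the squared modulus is again an integer polynomial in
  \<open>z\<close> and its trace is an integer.\<close>

lemma sum_norm_squared_Ints:
  assumes "m > 0"
  shows "(\<Sum>z\<in>primroots m. norm (ev P z) ^ 2) \<in> \<int>"
proof -
  have "complex_of_real (\<Sum>z\<in>primroots m. norm (ev P z) ^ 2) =
      (\<Sum>z\<in>primroots m. ev (P * pcompose P (monom 1 (m - 1))) z)"
    unfolding of_real_sum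
  proof (intro sum.cong refl)
    fix z assume "z \<in> primroots m"
    hence "cnj (ev P z) = ev P (z ^ (m - 1))"
      using primroots_cnj[of z m] assms by (simp add: ev_cnj)
    thus "complex_of_real (norm (ev P z) ^ 2) = ev (P * pcompose P (monom 1 (m - 1))) z"
      by (simp only: complex_norm_square ev_mult ev_pcompose ev_monom of_int_1 mult_1)
  qed
  also have "\<dots> \<in> \<int>" by (rule trace_Ints) fact
  finally show ?thesis by (auto simp del: of_real_sum elim!: Ints_cases)
qed

text \<open>There are at most \<open>m\<close> conjugates, so the trace of the squared modulus is a
  non-negative integer below 1, hence 0, and every summand vanishes.\<close>

lemma ev_eq_0_if_small:
  assumes "m > 0" "\<And>z. z \<in> primroots m \<Longrightarrow> norm (ev P z) ^ 2 < 1 / m" "z \<in> primroots m"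
  shows "ev P z = 0"
proof -
  define s where "s = (\<Sum>z\<in>primroots m. norm (ev P z) ^ 2)"
  have "s < (\<Sum>z\<in>primroots m. 1 / m)"
    unfolding s_def by (rule sum_strict_mono) (use assms finite_primroots in auto)
  also have "\<dots> \<le> 1" using card_primroots_le[OF assms(1)] assms(1) by (simp add: divide_simps)
  finally have "s < 1" .
  moreover have "s \<ge> 0" unfolding s_def by (rule sum_nonneg) auto
  moreover have "s \<in> \<int>" unfolding s_def by (rule sum_norm_squared_Ints) fact
  ultimately have "s = 0" by (auto elim!: Ints_cases)
  thus ?thesis using assms finite_primroots unfolding s_def by (subst (asm) sum_nonneg_eq_0_iff) auto
qed

subsection \<open>Frobenius congruences\<close>

lemma prime_dvd_power_add_diff:
  fixes x y :: "'a :: comm_ring_1"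
  assumes "prime p"
  shows "of_nat p dvd (x + y) ^ p - (x ^ p + y ^ p)"
proof -
  have p: "p > 0" "p \<noteq> 1" using assms prime_gt_0_nat prime_gt_1_nat by force+
  have "(x + y) ^ p = (\<Sum>k\<le>p. of_nat (p choose k) * x ^ k * y ^ (p - k))"
    by (rule binomial_ring)
  also have "{..p} = insert 0 (insert p {0<..<p})" using p by auto
  also have "(\<Sum>k\<in>\<dots>. of_nat (p choose k) * x ^ k * y ^ (p - k)) =
      y ^ p + (x ^ p + (\<Sum>k\<in>{0<..<p}. of_nat (p choose k) * x ^ k * y ^ (p - k)))"
    using p by simp
  finally have "(x + y) ^ p - (x ^ p + y ^ p) =
      (\<Sum>k\<in>{0<..<p}. of_nat (p choose k) * x ^ k * y ^ (p - k))" by simp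
  also have "of_nat p dvd \<dots>"
  proof (rule dvd_sum)
    fix k assume k: "k \<in> {0<..<p}"
    have "p dvd (p choose k)" by (rule dvd_choose_prime) (use k assms in auto)
    thus "of_nat p dvd of_nat (p choose k) * x ^ k * y ^ (p - k)"
      by (auto elim!: dvdE simp: mult.assoc)
  qed
  finally show ?thesis .
qed

text \<open>Fermat's little theorem by induction. Negative \<open>a\<close> is reached by expanding
  \<open>(a + (- a)) ^ p = 0\<close>, which covers \<open>p = 2\<close> without a parity
  distinction.\<close>

lemma prime_dvd_power_diff_self:
  fixes a :: int
  assumes "prime p"
  shows "int p dvd a ^ p - a"
proof -
  have p: "p > 0" using assms prime_gt_0_nat by auto
  have nat: "int p dvd int n ^ p - int n" for n
  proof (induction n)
    case (Suc n)
    have "int p dvd ((int n + 1) ^ p - (int n ^ p + 1 ^ p)) + (int n ^ p - int n)"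
      using prime_dvd_power_add_diff[OF assms, of "int n" 1] Suc by (intro dvd_add) auto
    thus ?case by (simp add: algebra_simps)
  qed (use p in \<open>auto simp: power_0_left\<close>)
  show ?thesis
  proof (cases "a \<ge> 0")
    case True
    thus ?thesis using nat[of "nat a"] by simp
  next
    case False
    have "int p dvd (a + (- a)) ^ p - (a ^ p + (- a) ^ p)"
      by (rule prime_dvd_power_add_diff[OF assms, of a "- a", simplified of_nat_id])
    moreover have "int p dvd (- a) ^ p - (- a)"
      using nat[of "nat (- a)"] False by simp
    ultimately have "int p dvd ((a + (- a)) ^ p - (a ^ p + (- a) ^ p)) + ((- a) ^ p - (- a))"
      by (rule dvd_add)
    hence "int p dvd - (a ^ p - a)" using p by (simp add: power_0_left)
    thus ?thesis by (simp only: dvd_minus_iff)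
  qed
qed

text \<open>Splitting off the constant coefficient reduces the Frobenius congruence to additivity
  modulo \<open>p\<close>, Fermat's theorem for that coefficient and the inductive
  hypothesis.\<close>

lemma frobenius_poly:
  fixes A :: "int poly"
  assumes "prime p"
  shows "of_nat p dvd A ^ p - pcompose A (monom 1 p)"
proof (induction A)
  case 0
  show ?case using assms prime_gt_0_nat[of p] by (simp add: power_0_left)
next
  case (pCons a B)
  have 1: "of_nat p dvd ([:a:] + monom 1 1 * B) ^ p - ([:a:] ^ p + (monom 1 1 * B) ^ p)"
    by (rule prime_dvd_power_add_diff) fact
  obtain c where c: "a ^ p - a = int p * c" using prime_dvd_power_diff_self[OF assms, of a] by blast
  have 2: "of_nat p dvd [:a:] ^ p - [:a:]"
  proof
    have "[:a:] ^ p - [:a:] = [:a ^ p - a:]" by (simp add: poly_const_pow)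
    also have "\<dots> = of_nat p * [:c:]" unfolding c by (simp add: of_nat_poly)
    finally show "[:a:] ^ p - [:a:] = of_nat p * [:c:]" .
  qed
  have 3: "of_nat p dvd monom 1 p * (B ^ p - pcompose B (monom 1 p))"
    using pCons.IH by (rule dvd_mult)
  have eq: "pCons a B = [:a:] + monom 1 1 * B" by (simp add: monom_altdef)
  have "pcompose (pCons a B) (monom 1 p) = [:a:] + monom 1 p * pcompose B (monom 1 p)"
    by (simp add: pcompose_pCons)
  hence "pCons a B ^ p - pcompose (pCons a B) (monom 1 p) =
    (([:a:] + monom 1 1 * B) ^ p - ([:a:] ^ p + (monom 1 1 * B) ^ p))
    + ([:a:] ^ p - [:a:]) + monom 1 p * (B ^ p - pcompose B (monom 1 p))"
    unfolding eq by (simp add: power_mult_distrib monom_power algebra_simps)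
  thus ?case using 1 2 3 by (simp only: dvd_add)
qed

text \<open>The quotient by \<open>p\<close> comes from one integer polynomial \<open>U\<close>,
  uniformly in \<open>z\<close>, so it is integral at every conjugate.\<close>

lemma frobenius_ev:
  assumes "prime p"
  obtains U where "\<And>z. ev A z ^ p = ev A (z ^ p) + of_nat p * ev U z"
proof -
  obtain U where U: "A ^ p - pcompose A (monom 1 p) = of_nat p * U"
    using frobenius_poly[OF assms, of A] by blast
  have "ev A z ^ p = ev A (z ^ p) + of_nat p * ev U z" for z
    using arg_cong[OF U, of "\<lambda>Q. ev Q z"] by (simp add: algebra_simps)
  thus ?thesis by (rule that)
qed

section \<open>Irreducibility of the cyclotomic polynomials\<close>

subsection \<open>Conjugate roots of unity\<close>

lemma ex_prime_factor_ev:
  fixes P :: "int poly"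
  assumes "P \<noteq> 0" "ev P z = 0"
  obtains f where "prime f" "f dvd P" "ev f z = 0"
proof -
  have "P = 0 \<or> ev P z \<noteq> 0 \<or> (\<exists>f. prime f \<and> f dvd P \<and> ev f z = 0)"
  proof (induction P rule: prime_divisors_induct)
    case (unit P)
    then obtain Q where "P * Q = 1" by (metis dvdE)
    hence "ev P z * ev Q z = 1" using ev_mult[of P Q z] by simp
    thus ?case by auto
  next
    case (factor p P)
    thus ?case by (auto intro: dvd_mult)
  qed auto
  with assms that show ?thesis by blast
qed

text \<open>Take a vanishing polynomial of least degree and pass to a prime factor that still
  vanishes. Primality in the ring of integer polynomials makes divisibility hold there, not merely
  over the rationals.\<close>

lemma ex_minimal_int_poly:
  fixes P0 :: "int poly"
  assumes "P0 \<noteq> 0" "ev P0 z = 0"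
  obtains f where "f \<noteq> 0" "ev f z = 0" "degree f > 0"
    "\<And>P. ev P z = 0 \<Longrightarrow> degree P < degree f \<Longrightarrow> P = 0" "\<And>P. ev P z = 0 \<Longrightarrow> f dvd P"
proof -
  define Q where "Q = (\<lambda>d. \<exists>P. P \<noteq> 0 \<and> ev P z = 0 \<and> degree P = d)"
  have "Q (LEAST d. Q d)" by (rule LeastI[of _ "degree P0"]) (use assms Q_def in auto)
  then obtain P where P: "P \<noteq> 0" "ev P z = 0" "degree P = (LEAST d. Q d)" by (auto simp: Q_def)
  obtain f where f: "prime f" "f dvd P" "ev f z = 0" using ex_prime_factor_ev[OF P(1,2)] .
  have f0: "f \<noteq> 0" using f by auto
  have "degree f \<le> (LEAST d. Q d)" using dvd_imp_degree_le[OF f(2) P(1)] P(3) by simp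
  hence small: "R = 0" if "ev R z = 0" "degree R < degree f" for R
    using that not_less_Least[of "degree R" Q] unfolding Q_def by fastforce
  have deg: "degree f > 0"
  proof (rule ccontr)
    assume "\<not> degree f > 0"
    then obtain c where "f = [:c:]" by (metis degree_eq_zeroE neq0_conv)
    with f(3) f0 show False by simp
  qed
  have "f dvd R" if R: "ev R z = 0" for R
  proof -
    obtain a q where aq: "a \<noteq> 0" "smult a R = f * q + pseudo_mod R f"
      using pseudo_mod(1)[OF f0] by blast
    have "ev (smult a R) z = ev (pseudo_mod R f) z" unfolding aq(2) using f(3) by simp
    hence "ev (pseudo_mod R f) z = 0" using R by simp
    hence "pseudo_mod R f = 0" using pseudo_mod(2)[OF f0, of R] small by blast
    \<comment> \<open>The constant \<open>a\<close> from pseudo-division has smaller degree than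
      \<open>f\<close>, so the prime \<open>f\<close> must divide the other factor
      \<open>R\<close>.\<close>
    hence "f dvd [:a:] * R" using aq by auto
    moreover have "\<not> f dvd [:a:]" using dvd_imp_degree_le[of f "[:a:]"] aq(1) deg by auto
    ultimately show ?thesis using f(1) prime_dvd_mult_iff by blast
  qed
  with f0 f(3) deg small show ?thesis by (rule that)
qed

text \<open>Write \<open>x ^ m - 1 = f * g\<close> with \<open>f\<close> minimal for
  \<open>z\<close>, and let \<open>w = z ^ l\<close>. If \<open>f\<close> does not vanish at
  \<open>w\<close>, then \<open>g\<close> does, and the derivative gives
  \<open>m = w f(w) g'(w)\<close>. Since \<open>f(z) = 0\<close>, Frobenius makes
  \<open>f(w)\<close> divisible by \<open>l\<close>; so \<open>l\<close> divides \<open>m\<close>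
  among the integer polynomials in \<open>z\<close>, although \<open>l\<close> and \<open>m\<close>
  are coprime.\<close>

lemma ev_primroot_power_prime:
  assumes z: "z \<in> primroots m" "m > 0" and l: "prime l" "\<not> l dvd m" and P: "ev P z = 0"
  shows "ev P (z ^ l) = 0"
proof -
  define X :: "int poly" where "X = monom 1 m - 1"
  have evX: "ev X w = w ^ m - 1" for w by (simp add: X_def)
  have "coeff X m = 1" using z(2) by (simp add: X_def)
  hence X0: "X \<noteq> 0" by auto
  have "ev X z = 0" using z by (simp add: evX primroots_def)
  then obtain f where f: "f \<noteq> 0" "ev f z = 0" "degree f > 0"
    and small: "\<And>P. ev P z = 0 \<Longrightarrow> degree P < degree f \<Longrightarrow> P = 0"
    and dvd: "\<And>P. ev P z = 0 \<Longrightarrow> f dvd P"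
    using ex_minimal_int_poly[OF X0] by blast
  obtain g where g: "X = f * g" using dvd[OF \<open>ev X z = 0\<close>] by blast
  obtain Q where Q: "P = f * Q" using dvd[OF P] by blast
  have "ev f (z ^ l) = 0"
  proof (rule ccontr)
    assume nz: "ev f (z ^ l) \<noteq> 0"
    define w where "w = z ^ l"
    have "ev X w = (z ^ m) ^ l - 1" by (simp add: evX w_def mult.commute flip: power_mult)
    hence "ev X w = 0" using z by (simp add: primroots_def)
    hence gw: "ev g w = 0" using nz unfolding g w_def by simp
    have "ev (pderiv X) w = ev f w * ev (pderiv g) w"
      unfolding g pderiv_mult using gw by simp
    moreover have "pderiv X = monom (int m) (m - 1)"
      by (simp add: X_def pderiv_diff pderiv_monom)
    ultimately have "of_nat m * w ^ (m - 1) = ev f w * ev (pderiv g) w"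
      by simp
    hence "of_nat m * (w ^ (m - 1) * w) = w * ev f w * ev (pderiv g) w"
      by (metis mult.assoc mult.commute)
    moreover have "w ^ (m - 1) * w = 1"
      using \<open>ev X w = 0\<close> z(2) by (simp add: evX flip: power_Suc2)
    ultimately have m: "of_nat m = w * ev f w * ev (pderiv g) w" by (simp only: mult_1_right)
    obtain U where U: "\<And>z. ev f z ^ l = ev f (z ^ l) + of_nat l * ev U z"
      using frobenius_ev[OF l(1)] by blast
    have "l \<noteq> 0" using l(1) by auto
    hence "ev f w = of_nat l * ev (- U) z"
      using U[of z] f(2) by (simp add: w_def eq_neg_iff_add_eq_0 power_0_left)
    moreover define Y where "Y = monom 1 l * (- U) * pcompose (pderiv g) (monom 1 l)"
    ultimately have mY: "of_nat m = of_nat l * ev Y z"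
      unfolding m by (simp add: w_def)
    \<comment> \<open>Together with \<open>mY\<close>, a Bezout relation makes \<open>l\<close>
      invertible among the integer polynomials in \<open>z\<close>, with inverse
      \<open>ev W z\<close>.\<close>
    have "coprime (int l) (int m)" using l by (simp add: prime_imp_coprime)
    then obtain a b where ab: "a * int l + b * int m = 1" using bezout_int[of "int l" "int m"] by auto
    define W where "W = of_int a + of_int b * Y"
    have "of_int (a * int l + b * int m) = (of_nat l * ev W z :: complex)"
      unfolding W_def using mY by (simp add: algebra_simps)
    hence W: "of_nat l * ev W z = 1" using ab by simp
    \<comment> \<open>As a divisor of a monic polynomial, \<open>f\<close> has a unit as leading
      coefficient, so pseudo-division by \<open>f\<close> only introduces a unit
      \<open>e\<close>.\<close>
    have "lead_coeff f * lead_coeff g = lead_coeff X" unfolding g by (simp add: lead_coeff_mult)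
    also have "degree X = m"
    proof (rule antisym)
      show "degree X \<le> m" unfolding X_def by (intro degree_diff_le) (auto simp: degree_monom_le)
      show "m \<le> degree X" using \<open>coeff X m = 1\<close> by (intro le_degree) simp
    qed
    hence "lead_coeff X = 1" using \<open>coeff X m = 1\<close> by simp
    finally have unit: "is_unit (lead_coeff f)" by (metis dvd_triv_left)
    obtain q r where qr: "pseudo_divmod W f = (q, r)" by fastforce
    define e where "e = lead_coeff f ^ (Suc (degree W) - degree f)"
    have e: "smult e W = f * q + r" "r = 0 \<or> degree r < degree f"
      using pseudo_divmod[OF f(1) qr] by (auto simp: e_def)
    have "of_int e * ev W z = ev r z" using arg_cong[OF e(1), of "\<lambda>P. ev P z"] f(2) by simp
    \<comment> \<open>The polynomial \<open>e - l r\<close> vanishes at \<open>z\<close> and has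
      degree below that of \<open>f\<close>, so it is 0; its constant coefficient then says that
      \<open>l\<close> divides the unit \<open>e\<close>.\<close>
    hence "ev ([:e:] - smult (int l) r) z = of_int e * (1 - of_nat l * ev W z)"
      by (simp add: algebra_simps)
    hence "ev ([:e:] - smult (int l) r) z = 0" using W by simp
    moreover have "degree ([:e:] - smult (int l) r) < degree f"
      using e(2) f(3) by (intro degree_diff_less) auto
    ultimately have "[:e:] - smult (int l) r = 0" by (rule small)
    hence "coeff ([:e:] - smult (int l) r) 0 = 0" by simp
    hence "int l dvd e" by simp
    moreover have "is_unit e" unfolding e_def using unit by (simp add: power_abs)
    ultimately have "is_unit (int l)" using dvd_trans by blast
    thus False using l(1) by simp
  qed
  thus ?thesis unfolding Q by simp
qed

lemma ev_primroot_power_coprime: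
  assumes "m > 0" "coprime k m" "z \<in> primroots m" "ev P z = 0"
  shows "ev P (z ^ k) = 0"
  using assms(2-4)
proof (induction k arbitrary: z rule: prime_divisors_induct)
  case zero
  \<comment> \<open>Coprimality of 0 and \<open>m\<close> forces \<open>m = 1\<close>, hence
    \<open>z = 1\<close>.\<close>
  thus ?case by (auto simp: primroots_def)
next
  case (factor p k)
  have p: "\<not> p dvd m" using factor.hyps factor.prems(1) 
    by (metis coprime_common_divisor dvd_triv_left not_prime_unit)
  have "ev P (z ^ p) = 0" by (rule ev_primroot_power_prime) (use factor p assms in auto)
  moreover have "z ^ p \<in> primroots m" 
    by (rule primroots_power) (use factor.prems assms in auto)
  ultimately have "ev P ((z ^ p) ^ k) = 0"
    using factor.prems by (intro factor.IH) auto
  thus ?case by (simp add: power_mult)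
qed auto

text \<open>Any two primitive roots are coprime powers of each other. In this form irreducibility
  carries a polynomial relation from one root of unity to all its conjugates.\<close>

theorem ev_primroots_conjugate:
  assumes "m > 0" "z \<in> primroots m" "w \<in> primroots m" "ev P z = 0"
  shows "ev P w = 0"
proof -
  obtain k where "coprime k m" "w = z ^ k" using primroots_conjugate assms by metis
  thus ?thesis using ev_primroot_power_coprime assms by blast
qed

subsection \<open>Almost integral functions on primitive roots of unity\<close>

text \<open>
  An element of the cyclotomic field is represented by the function sending each primitive root
  \<open>z\<close> to the corresponding conjugate. Almost integrality replaces integral closure: it is
  visibly a ring property, and a power argument shows that no nonzero almost integral element has
  all its conjugates inside the open unit disc.
\<close>

definition cyc_int :: "nat \<Rightarrow> (complex \<Rightarrow> complex) \<Rightarrow> bool" where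
  "cyc_int m g \<longleftrightarrow> (\<exists>P. \<forall>z\<in>primroots m. g z = ev P z)"

lemma cyc_int_ev [simp, intro]: "cyc_int m (ev P)"
  by (auto simp: cyc_int_def)

lemma cyc_int_cong:
  "(\<And>z. z \<in> primroots m \<Longrightarrow> f z = g z) \<Longrightarrow> cyc_int m f \<longleftrightarrow> cyc_int m g"
  by (simp add: cyc_int_def)

lemma cyc_int_of_int [simp, intro]: "cyc_int m (\<lambda>z. of_int n)"
  unfolding cyc_int_def by (rule exI[of _ "of_int n"]) simp

lemma cyc_int_of_nat [simp, intro]: "cyc_int m (\<lambda>z. of_nat n)"
  using cyc_int_of_int[of m "int n"] by simp

lemma cyc_int_1 [simp, intro]: "cyc_int m (\<lambda>z. 1)"
  using cyc_int_of_int[of m 1] by simp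

lemma cyc_int_0 [simp, intro]: "cyc_int m (\<lambda>z. 0)"
  using cyc_int_of_int[of m 0] by simp

lemma cyc_int_add [intro]:
  assumes "cyc_int m f" "cyc_int m g"
  shows "cyc_int m (\<lambda>z. f z + g z)"
proof -
  obtain P Q where "\<forall>z\<in>primroots m. f z = ev P z" "\<forall>z\<in>primroots m. g z = ev Q z"
    using assms unfolding cyc_int_def by blast
  thus ?thesis unfolding cyc_int_def by (intro exI[of _ "P + Q"]) auto
qed

lemma cyc_int_mult [intro]:
  assumes "cyc_int m f" "cyc_int m g"
  shows "cyc_int m (\<lambda>z. f z * g z)"
proof -
  obtain P Q where "\<forall>z\<in>primroots m. f z = ev P z" "\<forall>z\<in>primroots m. g z = ev Q z"
    using assms unfolding cyc_int_def by blast
  thus ?thesis unfolding cyc_int_def by (intro exI[of _ "P * Q"]) auto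
qed

lemma cyc_int_uminus [intro]: "cyc_int m f \<Longrightarrow> cyc_int m (\<lambda>z. - f z)"
  using cyc_int_mult[OF cyc_int_of_int[of m "-1"], of f] by simp

lemma cyc_int_power [intro]: "cyc_int m f \<Longrightarrow> cyc_int m (\<lambda>z. f z ^ n)"
  by (induction n) auto

lemma cyc_int_sum [intro]:
  "(\<And>x. x \<in> X \<Longrightarrow> cyc_int m (f x)) \<Longrightarrow> cyc_int m (\<lambda>z. \<Sum>x\<in>X. f x z)"
  by (induction X rule: infinite_finite_induct) auto

text \<open>In the representation by functions, precomposition with \<open>z ^ k\<close> is the
  Galois action.\<close>

lemma cyc_int_compose_power [intro]:
  assumes "cyc_int m f" "m > 0" "coprime k m"
  shows "cyc_int m (\<lambda>z. f (z ^ k))"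
proof -
  obtain P where P: "\<forall>z\<in>primroots m. f z = ev P z" using assms(1) unfolding cyc_int_def by blast
  have "\<forall>z\<in>primroots m. f (z ^ k) = ev (pcompose P (monom 1 k)) z"
    using P primroots_power[OF _ assms(2,3)] by simp
  thus ?thesis unfolding cyc_int_def by blast
qed

definition almost_int :: "nat \<Rightarrow> (complex \<Rightarrow> complex) \<Rightarrow> bool" where
  "almost_int m g \<longleftrightarrow> (\<exists>d. cyc_int m d \<and> (\<forall>z\<in>primroots m. d z \<noteq> 0) \<and>
     (\<forall>t. cyc_int m (\<lambda>z. d z * g z ^ t)))"

lemma almost_intI:
  assumes "cyc_int m d" "\<And>z. z \<in> primroots m \<Longrightarrow> d z \<noteq> 0" "\<And>t. cyc_int m (\<lambda>z. d z * g z ^ t)"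
  shows "almost_int m g"
  using assms unfolding almost_int_def by blast

lemma almost_intE:
  assumes "almost_int m g"
  obtains d where "cyc_int m d" "\<And>z. z \<in> primroots m \<Longrightarrow> d z \<noteq> 0"
    "\<And>t. cyc_int m (\<lambda>z. d z * g z ^ t)"
  using assms unfolding almost_int_def by blast

lemma almost_int_cong:
  assumes "\<And>z. z \<in> primroots m \<Longrightarrow> f z = g z"
  shows "almost_int m f \<longleftrightarrow> almost_int m g"
proof -
  have "cyc_int m (\<lambda>z. d z * f z ^ t) \<longleftrightarrow> cyc_int m (\<lambda>z. d z * g z ^ t)" for d t
    by (rule cyc_int_cong) (use assms in auto)
  thus ?thesis unfolding almost_int_def by simp
qed

lemma cyc_int_imp_almost_int: "cyc_int m f \<Longrightarrow> almost_int m f"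
  by (rule almost_intI[of m "\<lambda>_. 1"]) auto

lemma almost_int_mult:
  assumes "almost_int m f" "almost_int m g"
  shows "almost_int m (\<lambda>z. f z * g z)"
proof -
  obtain d where d: "cyc_int m d" "\<And>z. z \<in> primroots m \<Longrightarrow> d z \<noteq> 0"
    "\<And>t. cyc_int m (\<lambda>z. d z * f z ^ t)" using almost_intE[OF assms(1)] by blast
  obtain e where e: "cyc_int m e" "\<And>z. z \<in> primroots m \<Longrightarrow> e z \<noteq> 0"
    "\<And>t. cyc_int m (\<lambda>z. e z * g z ^ t)" using almost_intE[OF assms(2)] by blast
  show ?thesis
  proof (rule almost_intI[of m "\<lambda>z. d z * e z"])
    fix t
    show "cyc_int m (\<lambda>z. d z * e z * (f z * g z) ^ t)"
      using cyc_int_mult[OF d(3)[of t] e(3)[of t]] by (simp add: power_mult_distrib mult_ac)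
  qed (use d e in auto)
qed

text \<open>The product of the two denominators clears every term of the binomial expansion.\<close>

lemma almost_int_add:
  assumes "almost_int m f" "almost_int m g"
  shows "almost_int m (\<lambda>z. f z + g z)"
proof -
  obtain d where d: "cyc_int m d" "\<And>z. z \<in> primroots m \<Longrightarrow> d z \<noteq> 0"
    "\<And>t. cyc_int m (\<lambda>z. d z * f z ^ t)" using almost_intE[OF assms(1)] by blast
  obtain e where e: "cyc_int m e" "\<And>z. z \<in> primroots m \<Longrightarrow> e z \<noteq> 0"
    "\<And>t. cyc_int m (\<lambda>z. e z * g z ^ t)" using almost_intE[OF assms(2)] by blast
  show ?thesis
  proof (rule almost_intI[of m "\<lambda>z. d z * e z"])
    fix t
    have "cyc_int m (\<lambda>z. \<Sum>i\<le>t. of_nat (t choose i) * ((d z * f z ^ i) * (e z * g z ^ (t - i))))"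
      by (intro cyc_int_sum cyc_int_mult[OF cyc_int_of_nat] cyc_int_mult[OF d(3) e(3)])
    thus "cyc_int m (\<lambda>z. d z * e z * (f z + g z) ^ t)"
      by (simp add: binomial_ring sum_distrib_left mult_ac)
  qed (use d e in auto)
qed

lemma almost_int_power: "almost_int m f \<Longrightarrow> almost_int m (\<lambda>z. f z ^ n)"
  by (induction n) (auto intro: cyc_int_imp_almost_int almost_int_mult)

lemma almost_int_sum:
  "(\<And>x. x \<in> X \<Longrightarrow> almost_int m (f x)) \<Longrightarrow> almost_int m (\<lambda>z. \<Sum>x\<in>X. f x z)"
  by (induction X rule: infinite_finite_induct) (auto intro: cyc_int_imp_almost_int almost_int_add)

lemma almost_int_compose_power:
  assumes "almost_int m f" "m > 0" "coprime k m"
  shows "almost_int m (\<lambda>z. f (z ^ k))"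
proof -
  obtain d where d: "cyc_int m d" "\<And>z. z \<in> primroots m \<Longrightarrow> d z \<noteq> 0"
    "\<And>t. cyc_int m (\<lambda>z. d z * f z ^ t)" using almost_intE[OF assms(1)] by blast
  show ?thesis
    by (rule almost_intI[of m "\<lambda>z. d (z ^ k)"])
       (use d assms cyc_int_compose_power[OF d(3)] in \<open>auto intro: primroots_power\<close>)
qed

text \<open>Reduce \<open>t\<close> modulo \<open>n\<close> to \<open>s\<close>: then
  \<open>g ^ t\<close> is \<open>g ^ s\<close> times a power of the integral \<open>g ^ n\<close>,
  and the fixed denominator \<open>v ^ n\<close> supplies the \<open>v ^ s\<close> that clears
  \<open>g ^ s\<close>.\<close>

lemma almost_int_root:
  assumes "n > 0" "cyc_int m (\<lambda>z. g z ^ n)" "cyc_int m v" "\<And>z. z \<in> primroots m \<Longrightarrow> v z \<noteq> 0"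
    "cyc_int m (\<lambda>z. v z * g z)"
  shows "almost_int m g"
proof (rule almost_intI[of m "\<lambda>z. v z ^ n"])
  fix t
  define s where "s = t mod n"
  have s: "s < n" using assms(1) by (simp add: s_def)
  have "v z ^ n * g z ^ t = v z ^ (n - s) * (v z * g z) ^ s * (g z ^ n) ^ (t div n)" for z
  proof -
    have "g z ^ t = g z ^ (s + n * (t div n))" by (simp add: s_def)
    also have "\<dots> = g z ^ s * (g z ^ n) ^ (t div n)" by (simp only: power_add power_mult)
    finally have 1: "g z ^ t = g z ^ s * (g z ^ n) ^ (t div n)" .
    have "v z ^ n = v z ^ (n - s) * v z ^ s" using s by (simp flip: power_add)
    with 1 show ?thesis by (simp add: power_mult_distrib mult_ac)
  qed
  thus "cyc_int m (\<lambda>z. v z ^ n * g z ^ t)"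
    by (simp only:) (intro cyc_int_mult cyc_int_power[OF assms(5)]
      cyc_int_power[OF assms(3)] cyc_int_power[OF assms(2)])
qed (use assms in auto)

text \<open>All \<open>d z * g z ^ t\<close> are integral, while for large \<open>t\<close> they are
  tiny at each of the finitely many conjugates; the trace criterion makes one of them vanish, and
  \<open>d\<close> has no zero.\<close>

lemma almost_int_eq_0:
  assumes "m > 0" "almost_int m g" "\<And>z. z \<in> primroots m \<Longrightarrow> norm (g z) < 1" "z \<in> primroots m"
  shows "g z = 0"
proof -
  obtain d where d: "cyc_int m d" "\<And>z. z \<in> primroots m \<Longrightarrow> d z \<noteq> 0"
    "\<And>t. cyc_int m (\<lambda>z. d z * g z ^ t)" using almost_intE[OF assms(2)] by blast
  have "eventually (\<lambda>t. norm (d z * g z ^ t) ^ 2 < 1 / m) sequentially" if "z \<in> primroots m" for z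
  proof -
    have "(\<lambda>t. g z ^ t) \<longlonglongrightarrow> 0" by (rule LIMSEQ_power_zero) (rule assms(3)[OF that])
    hence lim: "(\<lambda>t. norm (d z * g z ^ t) ^ 2) \<longlonglongrightarrow> norm (d z * 0) ^ 2"
      by (intro tendsto_power[OF tendsto_norm[OF tendsto_mult[OF tendsto_const]]])
    show ?thesis by (rule order_tendstoD(2)[OF lim]) (use assms(1) in simp)
  qed
  hence "eventually (\<lambda>t. \<forall>z\<in>primroots m. norm (d z * g z ^ t) ^ 2 < 1 / m) sequentially"
    by (intro eventually_ball_finite finite_primroots assms ballI)
  then obtain t where t: "\<forall>z\<in>primroots m. norm (d z * g z ^ t) ^ 2 < 1 / m"
    unfolding eventually_sequentially by blast
  obtain P where P: "\<forall>z\<in>primroots m. d z * g z ^ t = ev P z" using d(3)[of t] unfolding cyc_int_def by blast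
  have "ev P z = 0" by (rule ev_eq_0_if_small[of m]) (use t P assms in auto)
  thus ?thesis using P d assms(4) by auto
qed

section \<open>Invertibility modulo a natural number\<close>

definition unit_mod :: "nat \<Rightarrow> nat \<Rightarrow> (complex \<Rightarrow> complex) \<Rightarrow> bool" where
  "unit_mod q m g \<longleftrightarrow> cyc_int m g \<and> (\<exists>u x. cyc_int m u \<and> cyc_int m x \<and>
     (\<forall>z\<in>primroots m. g z * u z = 1 + of_nat q * x z))"

lemma unit_modE:
  assumes "unit_mod q m g"
  obtains u x where "cyc_int m g" "cyc_int m u" "cyc_int m x"
     "\<And>z. z \<in> primroots m \<Longrightarrow> g z * u z = 1 + of_nat q * x z"
  using assms unfolding unit_mod_def by blast

lemma unit_mod_mult:
  assumes "unit_mod q m f" "unit_mod q m g"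
  shows "unit_mod q m (\<lambda>z. f z * g z)"
proof -
  from assms(1) obtain u x where 1: "cyc_int m f" "cyc_int m u" "cyc_int m x"
     "\<And>z. z \<in> primroots m \<Longrightarrow> f z * u z = 1 + of_nat q * x z" by (rule unit_modE) blast
  from assms(2) obtain v y where 2: "cyc_int m g" "cyc_int m v" "cyc_int m y"
     "\<And>z. z \<in> primroots m \<Longrightarrow> g z * v z = 1 + of_nat q * y z" by (rule unit_modE) blast
  have "f z * g z * (u z * v z) = 1 + of_nat q * (x z + y z + of_nat q * x z * y z)"
    if "z \<in> primroots m" for z
  proof -
    have "f z * g z * (u z * v z) = (f z * u z) * (g z * v z)" by (simp only: mult_ac)
    also have "\<dots> = (1 + of_nat q * x z) * (1 + of_nat q * y z)" using 1(4) 2(4) that by simp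
    finally show ?thesis by (simp add: algebra_simps)
  qed
  moreover have "cyc_int m (\<lambda>z. f z * g z)" "cyc_int m (\<lambda>z. u z * v z)"
     "cyc_int m (\<lambda>z. x z + y z + of_nat q * x z * y z)"
    by (intro cyc_int_add cyc_int_mult cyc_int_of_nat 1 2)+
  ultimately show ?thesis unfolding unit_mod_def by blast
qed

lemma unit_mod_power: "unit_mod q m f \<Longrightarrow> unit_mod q m (\<lambda>z. f z ^ n)"
proof (induction n)
  case 0
  show ?case unfolding unit_mod_def
    by (intro conjI exI[of _ "\<lambda>_. 1"] exI[of _ "\<lambda>_. 0"]) auto
qed (auto intro: unit_mod_mult)

lemma unit_mod_compose_power:
  assumes "unit_mod q m f" "m > 0" "coprime k m"
  shows "unit_mod q m (\<lambda>z. f (z ^ k))"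
proof -
  from assms(1) obtain u x where "cyc_int m f" "cyc_int m u" "cyc_int m x"
     "\<And>z. z \<in> primroots m \<Longrightarrow> f z * u z = 1 + of_nat q * x z" by (rule unit_modE) blast
  thus ?thesis unfolding unit_mod_def using assms(2,3)
    by (intro conjI exI[of _ "\<lambda>z. u (z ^ k)"] exI[of _ "\<lambda>z. x (z ^ k)"])
       (auto intro: primroots_power)
qed

text \<open>With \<open>y = - q x\<close> the product \<open>f u\<close> equals
  \<open>1 - y\<close>. Multiplying by the truncated geometric series turns it into
  \<open>1 - y ^ n\<close>, and \<open>q ^ n\<close> divides \<open>y ^ n\<close>.\<close>

lemma unit_mod_modulus_power:
  assumes "unit_mod q m f"
  shows "unit_mod (q ^ n) m f"
proof -
  from assms(1) obtain u x where 1: "cyc_int m f" "cyc_int m u" "cyc_int m x"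
     "\<And>z. z \<in> primroots m \<Longrightarrow> f z * u z = 1 + of_nat q * x z" by (rule unit_modE) blast
  define y where "y = (\<lambda>z. - (of_nat q * x z))"
  have y: "cyc_int m y" unfolding y_def by (intro cyc_int_uminus cyc_int_mult cyc_int_of_nat 1)
  show ?thesis unfolding unit_mod_def
  proof (intro conjI exI ballI)
    show "cyc_int m (\<lambda>z. u z * (\<Sum>i<n. y z ^ i))" using 1 y by (intro cyc_int_mult cyc_int_sum cyc_int_power)
    show "cyc_int m (\<lambda>z. - ((- x z) ^ n))" by (intro cyc_int_uminus cyc_int_power 1)
    fix z assume "z \<in> primroots m"
    hence "f z * (u z * (\<Sum>i<n. y z ^ i)) = (1 - y z) * (\<Sum>i<n. y z ^ i)"
      using 1(4) by (simp add: y_def flip: mult.assoc)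
    also have "\<dots> = 1 - y z ^ n" by (rule one_diff_power_eq[symmetric])
    also have "y z ^ n = (of_nat q * - x z) ^ n" by (simp add: y_def)
    finally show "f z * (u z * (\<Sum>i<n. y z ^ i)) = 1 + of_nat (q ^ n) * - ((- x z) ^ n)"
      by (simp only: power_mult_distrib of_nat_power) (simp add: algebra_simps)
  qed (use 1 in auto)
qed

text \<open>From \<open>w u = 1 + q x\<close> and \<open>g w = q y\<close> follows
  \<open>g / q = u y - x g\<close>, which is almost integral.\<close>

lemma almost_int_divide:
  assumes "almost_int m g" "q > 0" "unit_mod q m w" "cyc_int m y"
    "\<And>z. z \<in> primroots m \<Longrightarrow> g z * w z = of_nat q * y z"
  shows "almost_int m (\<lambda>z. g z / of_nat q)"
proof -
  from assms(3) obtain u x where 1: "cyc_int m w" "cyc_int m u" "cyc_int m x"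
     "\<And>z. z \<in> primroots m \<Longrightarrow> w z * u z = 1 + of_nat q * x z" by (rule unit_modE) blast
  have "almost_int m (\<lambda>z. u z * y z + (- x z) * g z)"
    by (intro almost_int_add almost_int_mult[OF _ assms(1)] cyc_int_imp_almost_int
        cyc_int_uminus cyc_int_mult 1 assms(4))
  moreover have "u z * y z + (- x z) * g z = g z / of_nat q" if z: "z \<in> primroots m" for z
  proof -
    have "of_nat q * (u z * y z) = g z * (w z * u z)" using assms(5)[OF z] by (simp add: mult_ac)
    also have "\<dots> = g z + of_nat q * (x z * g z)" unfolding 1(4)[OF z] by (simp add: algebra_simps)
    finally show ?thesis using assms(2) by (simp add: field_simps)
  qed
  ultimately show ?thesis using almost_int_cong[of m "\<lambda>z. u z * y z + (- x z) * g z"] by simp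
qed

text \<open>
  With \<open>\<alpha> = a/b\<close>, the element \<open>\<beta> = \<alpha>(z)^p - \<alpha>(z^k)^e\<close> is divisible by \<open>p\<close>, whereas the relation
  \<open>\<alpha>^n = c/d\<close> with large \<open>n\<close> keeps the conjugates of \<open>\<beta>\<close> essentially below 2. Hence the almost
  integral element \<open>d(z)^p d(z^k)^e (\<beta>/p)^n\<close> has only small conjugates and vanishes.
\<close>

lemma congruence_imp_eq:
  fixes a b c d F :: "complex \<Rightarrow> complex" and M :: real
  assumes m: "m > 0" "coprime k m" and p: "p > 0" "e \<le> p" and n: "n > 0"
    and int: "cyc_int m a" "cyc_int m b" "cyc_int m c" "cyc_int m d" "cyc_int m F"
    and nz: "\<And>z. z \<in> primroots m \<Longrightarrow> b z \<noteq> 0" "\<And>z. z \<in> primroots m \<Longrightarrow> d z \<noteq> 0"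
    and rel: "\<And>z. z \<in> primroots m \<Longrightarrow> a z ^ n * d z = b z ^ n * c z"
    and cong: "\<And>z. z \<in> primroots m \<Longrightarrow>
      a z ^ p * b (z ^ k) ^ e - a (z ^ k) ^ e * b z ^ p = of_nat p * F z"
    and unit: "unit_mod p m b"
    and M: "M \<ge> 1" "\<And>z. z \<in> primroots m \<Longrightarrow> norm (c z) \<le> M" "\<And>z. z \<in> primroots m \<Longrightarrow> norm (d z) \<le> M"
    and small: "(2 / real p) ^ n * M ^ (2 * p) < 1"
    and z: "z \<in> primroots m"
  shows "a z ^ p * b (z ^ k) ^ e = a (z ^ k) ^ e * b z ^ p"
proof -
  define \<alpha> where "\<alpha> = (\<lambda>z. a z / b z)"
  \<comment> \<open>The exponent \<open>e\<close> serves two congruences: it is 1 for the Frobenius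
    automorphism and \<open>p\<close> for rotation by a \<open>p\<close>-th root of unity.\<close>
  define \<beta> where "\<beta> = (\<lambda>z. \<alpha> z ^ p - \<alpha> (z ^ k) ^ e)"
  define \<gamma> where "\<gamma> = (\<lambda>z. d z ^ p * d (z ^ k) ^ e * \<beta> z ^ n)"
  have zk: "z ^ k \<in> primroots m" if "z \<in> primroots m" for z
    using primroots_power[OF that m] .
  have rel': "d z * \<alpha> z ^ n = c z" if "z \<in> primroots m" for z
    using rel[OF that] nz[OF that] by (simp add: \<alpha>_def power_divide field_simps)
  \<comment> \<open>By \<open>rel'\<close> the \<open>n\<close>-th power of
    \<open>d z * \<alpha> z ^ i\<close> is the integral \<open>d z ^ (n - i) * c z ^ i\<close>, so a
    single factor \<open>d\<close> suffices for every exponent up to \<open>n\<close>.\<close>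
  have AI: "almost_int m (\<lambda>z. d z * \<alpha> z ^ i)" if "i \<le> n" for i
  proof (rule almost_int_root[where v = "\<lambda>z. b z ^ i" and n = n])
    have "(d z * \<alpha> z ^ i) ^ n = d z ^ (n - i) * c z ^ i" if "z \<in> primroots m" for z
    proof -
      have "(d z * \<alpha> z ^ i) ^ n = d z ^ (n - i) * d z ^ i * (\<alpha> z ^ i) ^ n"
        using \<open>i \<le> n\<close> by (simp add: power_mult_distrib flip: power_add)
      also have "(\<alpha> z ^ i) ^ n = (\<alpha> z ^ n) ^ i" by (simp add: mult.commute flip: power_mult)
      also have "d z ^ (n - i) * d z ^ i * (\<alpha> z ^ n) ^ i = d z ^ (n - i) * (d z * \<alpha> z ^ n) ^ i"
        by (simp add: power_mult_distrib)
      finally show ?thesis using rel'[OF that] by simp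
    qed
    hence "cyc_int m (\<lambda>z. (d z * \<alpha> z ^ i) ^ n) \<longleftrightarrow> cyc_int m (\<lambda>z. d z ^ (n - i) * c z ^ i)"
      by (rule cyc_int_cong)
    thus "cyc_int m (\<lambda>z. (d z * \<alpha> z ^ i) ^ n)" using int by auto
    have "cyc_int m (\<lambda>z. b z ^ i * (d z * \<alpha> z ^ i)) \<longleftrightarrow> cyc_int m (\<lambda>z. d z * a z ^ i)"
      by (rule cyc_int_cong) (use nz in \<open>auto simp: \<alpha>_def power_divide\<close>)
    thus "cyc_int m (\<lambda>z. b z ^ i * (d z * \<alpha> z ^ i))" using int by auto
  qed (use n int nz in auto)
  \<comment> \<open>After binomial expansion the prefactor is distributed so that each
    \<open>\<alpha> z ^ i\<close> and each \<open>\<alpha> (z ^ k) ^ (n - i)\<close> receives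
    exactly one factor \<open>d\<close>; both exponents are at most \<open>n\<close>, so
    \<open>AI\<close> applies.\<close>
  have \<gamma>_eq: "\<gamma> = (\<lambda>z. \<Sum>i\<le>n. of_int (int (n choose i) * (-1) ^ (n - i)) *
     ((d z * \<alpha> z ^ i) ^ p * (d (z ^ k) * \<alpha> (z ^ k) ^ (n - i)) ^ e))"
  proof
    fix z
    have pc: "(x ^ s) ^ t = (x ^ t) ^ s" for x :: complex and s t
      by (simp add: mult.commute flip: power_mult)
    have "\<beta> z ^ n = (\<alpha> z ^ p + - (\<alpha> (z ^ k) ^ e)) ^ n" by (simp add: \<beta>_def)
    also have "\<dots> = (\<Sum>i\<le>n. of_nat (n choose i) * (\<alpha> z ^ p) ^ i * (- (\<alpha> (z ^ k) ^ e)) ^ (n - i))"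
      by (rule binomial_ring)
    also have "\<dots> = (\<Sum>i\<le>n. of_int (int (n choose i) * (-1) ^ (n - i)) *
       ((\<alpha> z ^ i) ^ p * (\<alpha> (z ^ k) ^ (n - i)) ^ e))"
      by (intro sum.cong refl)
         (simp add: power_minus[of "_ ^ e"] pc[of "\<alpha> z" p] pc[of "\<alpha> (z ^ k)" e])
    finally show "\<gamma> z = (\<Sum>i\<le>n. of_int (int (n choose i) * (-1) ^ (n - i)) *
      ((d z * \<alpha> z ^ i) ^ p * (d (z ^ k) * \<alpha> (z ^ k) ^ (n - i)) ^ e))"
      unfolding \<gamma>_def by (simp add: sum_distrib_left power_mult_distrib mult_ac)
  qed
  have "almost_int m \<gamma>"
    unfolding \<gamma>_eq
    by (intro almost_int_sum almost_int_mult almost_int_power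
          almost_int_compose_power[where f = "\<lambda>z. d z * \<alpha> z ^ _"] AI m
          cyc_int_imp_almost_int[OF cyc_int_of_int]) auto
  \<comment> \<open>\<open>w\<close> clears the denominators of \<open>\<beta> z ^ n\<close>. It is
    invertible modulo \<open>p ^ n\<close>, so divisibility by \<open>p ^ n\<close> passes from
    \<gamma> times \<open>w\<close> to \<gamma>.\<close>
  define w where "w = (\<lambda>z. (b z ^ p * b (z ^ k) ^ e) ^ n)"
  have w: "unit_mod (p ^ n) m w" unfolding w_def
    by (intro unit_mod_modulus_power unit_mod_power unit_mod_mult unit_mod_compose_power unit m)
  have \<beta>b: "\<beta> z * (b z ^ p * b (z ^ k) ^ e) = a z ^ p * b (z ^ k) ^ e - a (z ^ k) ^ e * b z ^ p"
    if "z \<in> primroots m" for z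
    using nz(1)[OF that] nz(1)[OF zk[OF that]]
    by (simp add: \<beta>_def \<alpha>_def power_divide field_simps)
  have "almost_int m (\<lambda>z. \<gamma> z / of_nat (p ^ n))"
  proof (rule almost_int_divide)
    show "cyc_int m (\<lambda>z. d z ^ p * d (z ^ k) ^ e * F z ^ n)"
      using int m by (intro cyc_int_mult cyc_int_power cyc_int_compose_power)
    fix z assume z: "z \<in> primroots m"
    have "\<gamma> z * w z = d z ^ p * d (z ^ k) ^ e * (\<beta> z * (b z ^ p * b (z ^ k) ^ e)) ^ n"
      by (simp add: \<gamma>_def w_def power_mult_distrib mult_ac)
    also have "\<beta> z * (b z ^ p * b (z ^ k) ^ e) = of_nat p * F z" using \<beta>b[OF z] cong[OF z] by simp
    finally show "\<gamma> z * w z = of_nat (p ^ n) * (d z ^ p * d (z ^ k) ^ e * F z ^ n)"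
      by (simp add: power_mult_distrib mult_ac)
  qed (use p w \<open>almost_int m \<gamma>\<close> in auto)
  moreover have "norm (\<gamma> z / of_nat (p ^ n)) < 1" if z: "z \<in> primroots m" for z
  proof -
    \<comment> \<open>The left side is the modulus of \<open>d z\<close> or, when \<alpha> lies
      outside the unit disc, that of \<open>c z\<close>.\<close>
    have *: "norm (d z) * max 1 (norm (\<alpha> z)) ^ n \<le> M" if z: "z \<in> primroots m" for z
    proof (cases "norm (\<alpha> z) \<le> 1")
      case True
      thus ?thesis using M(3)[OF z] by simp
    next
      case False
      thus ?thesis using arg_cong[OF rel'[OF z], of norm] M(2)[OF z]
        by (simp add: norm_mult norm_power max_def)
    qed
    define X where "X = max 1 (norm (\<alpha> z))"
    define Y where "Y = max 1 (norm (\<alpha> (z ^ k)))"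
    have XY: "X \<ge> 1" "Y \<ge> 1" by (auto simp: X_def Y_def)
    have XY': "X ^ p \<ge> 1" "Y ^ e \<ge> 1" using XY by auto
    have "norm (\<beta> z) \<le> norm (\<alpha> z) ^ p + norm (\<alpha> (z ^ k)) ^ e"
      unfolding \<beta>_def by (metis norm_power norm_triangle_ineq4)
    also have "\<dots> \<le> X ^ p + Y ^ e"
      by (intro add_mono power_mono) (auto simp: X_def Y_def)
    also have "\<dots> \<le> 2 * (X ^ p * Y ^ e)"
    proof -
      have "0 \<le> (X ^ p - 1) * Y ^ e + X ^ p * (Y ^ e - 1)"
        using XY' by (intro add_nonneg_nonneg mult_nonneg_nonneg) auto
      thus ?thesis by (simp add: algebra_simps)
    qed
    finally have "norm (\<beta> z) ^ n \<le> (2 * (X ^ p * Y ^ e)) ^ n" by (intro power_mono) auto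
    hence "norm (\<gamma> z) \<le> norm (d z) ^ p * norm (d (z ^ k)) ^ e * (2 * (X ^ p * Y ^ e)) ^ n"
      unfolding \<gamma>_def norm_mult norm_power by (intro mult_left_mono) auto
    also have "\<dots> = 2 ^ n * ((norm (d z) * X ^ n) ^ p * (norm (d (z ^ k)) * Y ^ n) ^ e)"
      by (simp add: power_mult_distrib mult_ac flip: power_mult)
    also have "\<dots> \<le> 2 ^ n * (M ^ p * M ^ e)"
      using *[OF z] *[OF zk[OF z]] XY M(1) unfolding X_def Y_def
      by (intro mult_left_mono mult_mono power_mono) auto
    also have "\<dots> \<le> 2 ^ n * M ^ (2 * p)"
      using M(1) p(2) by (intro mult_left_mono) (auto simp flip: power_add intro!: power_increasing)
    finally have "norm (\<gamma> z) / real p ^ n \<le> 2 ^ n * M ^ (2 * p) / real p ^ n"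
      by (rule divide_right_mono) simp
    also have "\<dots> < 1" using small by (simp add: power_divide)
    finally show ?thesis by (simp add: norm_divide norm_power)
  qed
  ultimately have "\<gamma> z / of_nat (p ^ n) = 0" using almost_int_eq_0[OF m(1)] z by blast
  hence "\<gamma> z = 0" using p by simp
  hence "\<beta> z = 0" using nz(2)[OF z] nz(2)[OF zk[OF z]] by (auto simp: \<gamma>_def)
  thus ?thesis using \<beta>b[OF z] by simp
qed

subsection \<open>Coincidences forcing monomials\<close>

text \<open>Factors \<open>x\<close> are stripped off; once the constant coefficient is non-zero
  there is no root at all, and the fundamental theorem of algebra leaves a constant.\<close>

lemma no_nonzero_root_imp_monom:
  fixes P :: "int poly"
  assumes "\<And>z. z \<noteq> 0 \<Longrightarrow> ev P z \<noteq> 0"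
  obtains a k where "P = monom a k"
proof -
  have "\<exists>a k. P = monom a k" using assms
  proof (induction P)
    case 0
    show ?case by (intro exI[of _ 0] exI[of _ 0]) simp
  next
    case (pCons a P)
    show ?case
    proof (cases "a = 0")
      case True
      hence "\<exists>b k. P = monom b k" using pCons.prems by (intro pCons.IH) auto
      thus ?thesis using True monom_Suc[symmetric] by metis
    next
      case False
      have "poly (map_poly of_int (pCons a P)) z \<noteq> (0 :: complex)" for z
        using pCons.prems[of z] False by (cases "z = 0") (auto simp: ev_def map_poly_pCons)
      hence "constant (poly (map_poly of_int (pCons a P) :: complex poly))"
        using fundamental_theorem_of_algebra by blast
      hence "degree (pCons a P) = 0"
        by (subst (asm) constant_degree) (subst (asm) degree_map_poly, auto)
      then obtain b where "pCons a P = [:b:]" by (elim degree_eq_zeroE)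
      thus ?thesis by (intro exI[of _ b] exI[of _ 0]) (simp add: monom_0)
    qed
  qed
  thus ?thesis using that by blast
qed

lemma card_ev_roots_le:
  assumes "P \<noteq> 0"
  shows "card {z. ev P z = 0} \<le> degree P"
proof -
  have "map_poly of_int P \<noteq> (0 :: complex poly)" using assms by (simp add: map_poly_eq_0_iff)
  from card_poly_roots_bound[OF this] show ?thesis by (simp add: ev_def degree_map_poly)
qed

lemma many_roots_imp_eq_0:
  assumes "degree P < card X" "\<And>z. z \<in> X \<Longrightarrow> ev P z = 0"
  shows "P = 0"
proof (rule ccontr)
  assume "P \<noteq> 0"
  hence "card X \<le> card {z. ev P z = 0}" using assms by (intro card_mono finite_ev_roots) auto
  with card_ev_roots_le[OF \<open>P \<noteq> 0\<close>] assms(1) show False by simp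
qed

text \<open>If \<open>A\<close> vanished at \<open>z \<noteq> 0\<close>, then, \<open>B\<close>
  being non-zero there, it would vanish at all \<open>p\<close> of the \<open>p\<close>-th roots of
  \<open>z\<close>, too many for its degree.\<close>

lemma frobenius_root_closure:
  assumes "A \<noteq> 0" "\<And>z. \<not> (ev A z = 0 \<and> ev B z = 0)" "degree A < p"
    and eq: "\<And>z. ev A z ^ p * ev B (z ^ p) = ev A (z ^ p) * ev B z ^ p"
    and z: "z \<noteq> 0"
  shows "ev A z \<noteq> 0"
proof
  assume Az: "ev A z = 0"
  have p: "p > 0" using assms(3) by simp
  have "A = 0"
  proof (rule many_roots_imp_eq_0[of _ "{y. y ^ p = z}"])
    show "degree A < card {y. y ^ p = z}" using card_nth_roots[OF z p] assms(3) by simp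
    fix y assume "y \<in> {y. y ^ p = z}"
    thus "ev A y = 0" using eq[of y] Az assms(2)[of z] by auto
  qed
  thus False using assms by simp
qed

text \<open>A root \<open>z \<noteq> 0\<close> of \<open>A\<close> propagates to \<open>w z\<close>,
  \<open>w ^ 2 z\<close> and so on, giving \<open>p\<close> distinct roots, more than the
  degree.\<close>

lemma rotation_root_closure:
  assumes "A \<noteq> 0" "\<And>z. \<not> (ev A z = 0 \<and> ev B z = 0)" "degree A < p"
    and w: "w \<in> primroots p"
    and eq: "\<And>z. ev A z ^ p * ev B (w * z) ^ p = ev A (w * z) ^ p * ev B z ^ p"
    and z: "z \<noteq> 0"
  shows "ev A z \<noteq> 0"
proof
  assume Az: "ev A z = 0"
  have p: "p > 0" using assms(3) by simp
  have rot: "ev A (w ^ i * z) = 0" for i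
  proof (induction i)
    case (Suc i)
    thus ?case using eq[of "w ^ i * z"] assms(2)[of "w ^ i * z"] p
      by (auto simp: mult.assoc power_0_left)
  qed (use Az in simp)
  have "A = 0"
  proof (rule many_roots_imp_eq_0[of _ "(\<lambda>i. w ^ i * z) ` {..<p}"])
    have "inj_on (\<lambda>i. w ^ i * z) {..<p}"
      using inj_on_primroot_powers[OF w p] z by (auto simp: inj_on_def)
    thus "degree A < card ((\<lambda>i. w ^ i * z) ` {..<p})" using assms(3) by (simp add: card_image)
  qed (use rot in auto)
  thus False using assms by simp
qed

text \<open>Infinitely many coincidences give a polynomial identity. It is symmetric in
  \<open>A\<close> and \<open>B\<close>, so neither has a non-zero root and both are
  monomials.\<close>

lemma finite_frobenius_coincidence:
  assumes AB: "A \<noteq> 0" "B \<noteq> 0" "\<And>z. \<not> (ev A z = 0 \<and> ev B z = 0)" "degree A < p" "degree B < p"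
    and not_monom: "\<not> ((\<exists>a k. A = monom a k) \<and> (\<exists>b l. B = monom b l))"
  shows "finite {z. ev A z ^ p * ev B (z ^ p) = ev A (z ^ p) * ev B z ^ p}"
proof (rule ccontr)
  define E where "E = A ^ p * pcompose B (monom 1 p) - pcompose A (monom 1 p) * B ^ p"
  assume "\<not> ?thesis"
  hence "infinite {z. ev E z = 0}" by (simp add: E_def)
  hence "E = 0" using finite_ev_roots by blast
  hence eq: "ev A z ^ p * ev B (z ^ p) = ev A (z ^ p) * ev B z ^ p" for z
  proof -
    have "ev E z = 0" using \<open>E = 0\<close> by simp
    thus ?thesis by (simp add: E_def)
  qed
  hence eq': "ev B z ^ p * ev A (z ^ p) = ev B (z ^ p) * ev A z ^ p" for z
    by (simp add: mult.commute)
  have BA: "\<not> (ev B z = 0 \<and> ev A z = 0)" for z using AB(3)[of z] by blast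
  obtain a k where "A = monom a k"
    using no_nonzero_root_imp_monom[OF frobenius_root_closure[OF AB(1,3,4) eq]] by blast
  moreover obtain b l where "B = monom b l"
    using no_nonzero_root_imp_monom[OF frobenius_root_closure[OF AB(2) BA AB(5) eq']] by blast
  ultimately show False using not_monom by blast
qed

lemma finite_rotation_coincidence:
  assumes AB: "A \<noteq> 0" "B \<noteq> 0" "\<And>z. \<not> (ev A z = 0 \<and> ev B z = 0)" "degree A < p" "degree B < p"
    and not_monom: "\<not> ((\<exists>a k. A = monom a k) \<and> (\<exists>b l. B = monom b l))"
    and w: "w \<in> primroots p"
  shows "finite {z. ev A z ^ p * ev B (w * z) ^ p = ev A (w * z) ^ p * ev B z ^ p}"
proof (rule ccontr)
  \<comment> \<open>Rotation by \<open>w\<close> brings in complex coefficients, so the difference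
    polynomial is formed over the complex numbers.\<close>
  define c :: "int poly \<Rightarrow> complex poly" where "c = map_poly of_int"
  define E where "E = c A ^ p * pcompose (c B) [:0, w:] ^ p - pcompose (c A) [:0, w:] ^ p * c B ^ p"
  have E: "poly E z = ev A z ^ p * ev B (w * z) ^ p - ev A (w * z) ^ p * ev B z ^ p" for z
    by (simp add: E_def c_def ev_def poly_pcompose mult.commute)
  assume "\<not> ?thesis"
  hence "infinite {z. poly E z = 0}" by (simp add: E)
  hence "E = 0" using poly_roots_finite by blast
  hence eq: "ev A z ^ p * ev B (w * z) ^ p = ev A (w * z) ^ p * ev B z ^ p" for z
    using E[of z] by simp
  hence eq': "ev B z ^ p * ev A (w * z) ^ p = ev B (w * z) ^ p * ev A z ^ p" for z
    using eq[of z] by (simp only: mult.commute)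
  have BA: "\<not> (ev B z = 0 \<and> ev A z = 0)" for z using AB(3)[of z] by blast
  obtain a k where "A = monom a k"
    using no_nonzero_root_imp_monom[OF rotation_root_closure[OF AB(1,3,4) w eq]] by blast
  moreover obtain b l where "B = monom b l"
    using no_nonzero_root_imp_monom[OF rotation_root_closure[OF AB(2) BA AB(5) w eq']] by blast
  ultimately show False using not_monom by blast
qed

subsection \<open>Invertibility modulo a prime\<close>

lemma finite_bounded_int_polys:
  "finite {P :: int poly. degree P \<le> d \<and> (\<forall>i. coeff P i \<in> {0..<q})}"
proof (rule finite_surj)
  show "finite {xs. set xs \<subseteq> {0..<q} \<and> length xs \<le> Suc d}"
    by (rule finite_lists_length_le) simp
  show "{P :: int poly. degree P \<le> d \<and> (\<forall>i. coeff P i \<in> {0..<q})} \<subseteq>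
    Poly ` {xs. set xs \<subseteq> {0..<q} \<and> length xs \<le> Suc d}"
  proof
    fix P :: "int poly" assume P: "P \<in> {P. degree P \<le> d \<and> (\<forall>i. coeff P i \<in> {0..<q})}"
    have "length (coeffs P) \<le> Suc d" using P by (cases "P = 0") (auto simp: length_coeffs_degree)
    moreover have "set (coeffs P) \<subseteq> {0..<q}" using P by (auto simp: coeffs_def)
    ultimately show "P \<in> Poly ` {xs. set xs \<subseteq> {0..<q} \<and> length xs \<le> Suc d}"
      by (intro image_eqI[of _ _ "coeffs P"]) auto
  qed
qed

text \<open>Inverting the leading coefficient modulo \<open>p\<close> gives a monic
  \<open>B1\<close> congruent to a multiple of \<open>B\<close>. Division by \<open>B1\<close> stays
  integral, and the remainder is then reduced coefficientwise.\<close>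

lemma power_residue_mod:
  fixes B :: "int poly"
  assumes p: "prime p" "\<not> int p dvd lead_coeff B"
  obtains R q V where "degree R \<le> degree B" "\<And>i. coeff R i \<in> {0..<int p}"
    "P = B * q + R + of_nat p * V"
proof -
  define l where "l = lead_coeff B"
  have "coprime (int p) l" using p by (simp add: l_def prime_imp_coprime)
  then obtain c b where bc: "c * int p + b * l = 1" using bezout_int[of "int p" l] by auto
  define B1 where "B1 = smult b B + smult (c * int p) (monom 1 (degree B))"
  have top: "coeff B1 (degree B) = 1" using bc by (simp add: B1_def l_def mult.commute)
  have "degree B1 \<le> degree B"
    unfolding B1_def by (intro degree_add_le) (auto intro: order.trans[OF degree_smult_le] degree_monom_le)
  moreover have "degree B1 \<ge> degree B" using top by (intro le_degree) simp
  ultimately have deg: "degree B1 = degree B" by simp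
  have B1: "B1 \<noteq> 0" using top by auto
  obtain q r where qr: "pseudo_divmod P B1 = (q, r)" by fastforce
  from pseudo_divmod[OF B1 qr] top deg
  have 1: "P = B1 * q + r" "r = 0 \<or> degree r < degree B" by auto
  define R where "R = map_poly (\<lambda>c. c mod int p) r"
  define V where "V = map_poly (\<lambda>c. c div int p) r"
  have p0: "p > 0" using p(1) prime_gt_0_nat by blast
  have "r = R + of_nat p * V"
    by (rule poly_eqI) (simp add: R_def V_def coeff_map_poly of_nat_poly)
  moreover have "B1 = B * [:b:] + of_nat p * smult c (monom 1 (degree B))"
    by (simp add: B1_def of_nat_poly mult.commute)
  ultimately have "P = B * ([:b:] * q) + R + of_nat p * (smult c (monom 1 (degree B)) * q + V)"
    unfolding 1(1) by (simp only: algebra_simps)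
  moreover have "degree R \<le> degree B" unfolding R_def using 1(2)
    by (intro order.trans[OF map_poly_degree_leq]) auto
  moreover have "coeff R i \<in> {0..<int p}" for i using p0 by (simp add: R_def coeff_map_poly)
  ultimately show ?thesis using that by blast
qed

text \<open>Pigeonhole on the powers of \<open>x\<close> in the finite ring \<open>\<int>[x]/(p, B)\<close>.\<close>

lemma ex_multiple_cyclic_mod:
  fixes B :: "int poly"
  assumes p: "prime p" "\<not> int p dvd lead_coeff B"
  obtains N i U V where "N > 0" "monom 1 i * (monom 1 N - 1) = B * U + of_nat p * V"
proof -
  define F where "F = {P :: int poly. degree P \<le> degree B \<and> (\<forall>i. coeff P i \<in> {0..<int p})}"
  have "\<exists>R q V. R \<in> F \<and> monom 1 i = B * q + R + of_nat p * V" for i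
  proof -
    obtain R q V where "degree R \<le> degree B" "\<And>i. coeff R i \<in> {0..<int p}"
      "monom 1 i = B * q + R + of_nat p * V"
      using power_residue_mod[OF p, where P = "monom 1 i"] by blast
    thus ?thesis unfolding F_def by blast
  qed
  hence "\<forall>i. \<exists>R q V. R \<in> F \<and> monom 1 i = B * q + R + of_nat p * V" by blast
  hence "\<exists>R q V. \<forall>i. R i \<in> F \<and> monom 1 i = B * q i + R i + of_nat p * V i"
    by (simp only: choice_iff)
  then obtain R q V where R: "\<And>i. R i \<in> F" "\<And>i. monom 1 i = B * q i + R i + of_nat p * V i"
    by blast
  have "finite F" unfolding F_def by (rule finite_bounded_int_polys)
  hence "finite (range R)" by (rule finite_subset[rotated]) (use R(1) in blast)
  hence "\<not> inj R" using finite_imageD infinite_UNIV_nat by blast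
  then obtain i j where "i \<noteq> j" "R i = R j" by (auto simp: inj_def)
  then obtain i j where ij: "i < j" "R i = R j" by (cases "i < j") (auto simp: not_less_iff_gr_or_eq)
  have "monom 1 i * (monom 1 (j - i) - 1) = monom 1 j - monom (1::int) i"
    using ij by (simp add: algebra_simps mult_monom)
  also have "\<dots> = B * (q j - q i) + of_nat p * (V j - V i)"
    unfolding R(2)[of j] R(2)[of i] using ij(2) by (simp add: algebra_simps)
  finally show ?thesis using ij(1) that[of "j - i"] by simp
qed

text \<open>In a field, if \<open>x ^ n = 1\<close> and \<open>x \<noteq> 1\<close>, the last sum
  vanishes, so this exhibits \<open>x - 1\<close> as a divisor of \<open>n\<close> with an explicit
  cofactor.\<close>

lemma sum_index_geometric:
  fixes x :: "'a :: comm_ring_1"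
  shows "(x - 1) * (\<Sum>i<n. of_nat i * x ^ i) = of_nat n * x ^ n - x * (\<Sum>i<n. x ^ i)"
  by (induction n) (simp_all add: algebra_simps)

text \<open>Modulo \<open>p\<close>, \<open>B\<close> divides \<open>z ^ i * (z ^ N - 1)\<close>, so
  it is enough that \<open>z ^ N - 1\<close> divides \<open>u\<close>, which is prime to
  \<open>p\<close>. It divides \<open>t - 1\<close> for \<open>t = z ^ (N * p ^ s)\<close>; this
  \<open>t\<close> is a \<open>u\<close>-th root of unity other than 1, whence \<open>t - 1\<close>
  divides \<open>u\<close>.\<close>

lemma unit_mod_evI:
  assumes m: "m = p ^ s * u" "m > 0" and p: "prime p" "\<not> p dvd u" and N: "\<not> u dvd N"
    and cyc: "monom 1 i * (monom 1 N - 1) = B * U + of_nat p * V"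
  shows "unit_mod p m (ev B)"
proof -
  have "coprime (int p) (int u)" using p by (simp add: prime_imp_coprime)
  then obtain b a where ab: "b * int p + a * int u = 1" using bezout_int[of "int p" "int u"] by auto
  \<comment> \<open>\<open>T\<close> is the cofactor of \<open>t - 1\<close> in \<open>u\<close>;
    \<open>G\<close> multiplies it by the quotient of \<open>t - 1\<close> by
    \<open>z ^ N - 1\<close> and by the inverse of \<open>z ^ i\<close>.\<close>
  define T :: "int poly" where "T = pcompose (\<Sum>j<u. of_nat j * monom 1 j) (monom 1 (N * p ^ s))"
  define G :: "int poly" where "G = (\<Sum>j<p ^ s. monom 1 (N * j)) * T * monom 1 (i * (m - 1))"
  have eq: "ev B z * ev (of_int a * U * G) z = 1 + of_nat p * ev (- of_int b - of_int a * V * G) z"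
    if z: "z \<in> primroots m" for z
  proof -
    define t where "t = z ^ (N * p ^ s)"
    have "\<not> m dvd N * p ^ s" using N m by (auto simp: mult.commute[of N])
    hence t1: "t \<noteq> 1" using primroots_power_eq_1_iff[OF z m(2)] by (simp add: t_def)
    have "t ^ u = (z ^ m) ^ N" by (simp add: t_def m(1) mult_ac flip: power_mult)
    hence tu: "t ^ u = 1" using z by (simp add: primroots_def)
    have "(t - 1) * (\<Sum>j<u. t ^ j) = 0" using power_diff_1_eq[of t u] tu by simp
    hence "(\<Sum>j<u. t ^ j) = 0" using t1 by simp
    hence 1: "(t - 1) * (\<Sum>j<u. of_nat j * t ^ j) = of_nat u"
      using sum_index_geometric[of t u] tu by simp
    have T: "ev T z = (\<Sum>j<u. of_nat j * t ^ j)"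
      by (simp add: T_def t_def power_mult)
    have "t - 1 = (z ^ N) ^ (p ^ s) - 1" by (simp add: t_def power_mult)
    also have "\<dots> = (z ^ N - 1) * (\<Sum>j<p ^ s. (z ^ N) ^ j)" by (rule power_diff_1_eq)
    finally have 2: "t - 1 = (z ^ N - 1) * (\<Sum>j<p ^ s. (z ^ N) ^ j)" .
    have "i + i * (m - 1) = m * i" using m(2) by (cases m) (auto simp: algebra_simps)
    hence "z ^ i * z ^ (i * (m - 1)) = (z ^ m) ^ i" by (simp only: flip: power_add power_mult)
    hence 3: "z ^ i * z ^ (i * (m - 1)) = 1" using z by (simp add: primroots_def)
    have G: "ev G z = (\<Sum>j<p ^ s. (z ^ N) ^ j) * ev T z * z ^ (i * (m - 1))"
      unfolding G_def ev_mult ev_sum ev_monom by (simp only: of_int_1 mult_1 power_mult)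
    have "z ^ i * (z ^ N - 1) * ev G z =
      (z ^ i * z ^ (i * (m - 1))) * ((z ^ N - 1) * (\<Sum>j<p ^ s. (z ^ N) ^ j)) * ev T z"
      unfolding G by (simp only: mult_ac)
    also have "\<dots> = of_nat u" using 1 2 3 T by simp
    finally have u: "z ^ i * (z ^ N - 1) * ev G z = of_nat u" .
    have "z ^ i * (z ^ N - 1) = ev B z * ev U z + of_nat p * ev V z"
      using arg_cong[OF cyc, of "\<lambda>P. ev P z"] by simp
    hence "ev B z * ev U z * ev G z = of_nat u - of_nat p * ev V z * ev G z"
      using u by (simp add: algebra_simps)
    hence "of_int a * (ev B z * ev U z * ev G z) = of_int a * (of_nat u - of_nat p * ev V z * ev G z)"
      by simp
    hence "ev B z * ev (of_int a * U * G) z = of_int (a * int u) - of_nat p * (of_int a * ev V z * ev G z)"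
      by (simp add: algebra_simps)
    also have "a * int u = 1 - b * int p" using ab by simp
    finally show ?thesis by (simp add: algebra_simps)
  qed
  show ?thesis unfolding unit_mod_def using eq cyc_int_ev by blast
qed

text \<open>Invertibility can fail for a prime only if the part of \<open>m\<close> prime to it
  divides the corresponding \<open>N1\<close> or \<open>N2\<close>. If both fail, the
  \<open>p1\<close>-part of \<open>m\<close>, lying in the part prime to \<open>p2\<close>, divides
  \<open>N2\<close>, so \<open>m\<close> divides \<open>N1 * N2\<close>.\<close>

lemma unit_mod_or_bounded_order:
  assumes p: "prime p1" "prime p2" "p1 \<noteq> p2"
    and B: "\<not> int p1 dvd lead_coeff B" "\<not> int p2 dvd lead_coeff B"
  obtains N where "N > 0" "\<And>m. m > 0 \<Longrightarrow> \<not> m dvd N \<Longrightarrow> unit_mod p1 m (ev B) \<or> unit_mod p2 m (ev B)"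
proof -
  obtain N1 i1 U1 V1 where 1: "N1 > 0" "monom 1 i1 * (monom 1 N1 - 1) = B * U1 + of_nat p1 * V1"
    by (rule ex_multiple_cyclic_mod[OF p(1) B(1)])
  obtain N2 i2 U2 V2 where 2: "N2 > 0" "monom 1 i2 * (monom 1 N2 - 1) = B * U2 + of_nat p2 * V2"
    by (rule ex_multiple_cyclic_mod[OF p(2) B(2)])
  show ?thesis
  proof (rule that[of "N1 * N2"])
    fix m assume m: "m > 0" "\<not> m dvd N1 * N2"
    obtain s u where su: "m = p1 ^ s * u" "\<not> p1 dvd u"
      using multiplicity_decompose'[of m p1] m(1) p(1) by (metis neq0_conv not_prime_unit)
    obtain t v where tv: "m = p2 ^ t * v" "\<not> p2 dvd v"
      using multiplicity_decompose'[of m p2] m(1) p(2) by (metis neq0_conv not_prime_unit)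
    have "\<not> u dvd N1 \<or> \<not> v dvd N2"
    proof (rule ccontr)
      assume "\<not> (\<not> u dvd N1 \<or> \<not> v dvd N2)"
      hence dvd: "u dvd N1" "v dvd N2" by auto
      have "coprime (p1 ^ s) (p2 ^ t)" using p by (simp add: primes_coprime)
      moreover have "p1 ^ s dvd p2 ^ t * v" using su(1) tv(1) by (metis dvd_triv_left)
      ultimately have "p1 ^ s dvd v" by (simp add: coprime_dvd_mult_right_iff)
      hence "m dvd N2 * N1" unfolding su(1) using dvd by (intro mult_dvd_mono) auto
      thus False using m(2) by (simp add: mult.commute)
    qed
    thus "unit_mod p1 m (ev B) \<or> unit_mod p2 m (ev B)"
      using unit_mod_evI[OF su(1) m(1) p(1) su(2) _ 1(2)]
            unit_mod_evI[OF tv(1) m(1) p(2) tv(2) _ 2(2)] by blast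
  qed (use 1(1) 2(1) in auto)
qed

subsection \<open>Power relations at infinitely many roots of unity\<close>

text \<open>With \<open>r = m div p\<close>, the prime \<open>p\<close> cannot divide both
  \<open>1 + r\<close> and \<open>1 + 2 * r\<close>, so \<open>j\<close> can be 1 or 2; any other
  prime factor of \<open>m\<close> divides \<open>r\<close> and hence not
  \<open>1 + j * r\<close>.\<close>

lemma ex_coprime_shift:
  fixes p m :: nat
  assumes p: "prime p" "p > 2" "p dvd m" "m > 0"
  obtains j where "0 < j" "j < p" "coprime (1 + j * (m div p)) m"
proof -
  define r where "r = m div p"
  have m: "m = p * r" using p by (simp add: r_def)
  have "\<not> p dvd 1 + 1 * r \<or> \<not> p dvd 1 + 2 * r"
  proof (rule ccontr)
    assume "\<not> ?thesis"
    hence *: "p dvd 1 + 1 * r" "p dvd 1 + 2 * r" by auto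
    hence "p dvd (1 + 2 * r) - (1 + 1 * r)" by (rule dvd_diff_nat[rotated])
    hence "p dvd r" by simp
    hence "p dvd 1" using *(1) by (metis dvd_add_left_iff mult_1)
    thus False using p by auto
  qed
  then obtain j where j: "j \<in> {1, 2}" "\<not> p dvd 1 + j * r" by blast
  have "coprime (1 + j * r) m"
  proof (rule ccontr)
    assume "\<not> ?thesis"
    hence "gcd (1 + j * r) m \<noteq> 1" by (simp add: coprime_iff_gcd_eq_1)
    then obtain q where "prime q" "q dvd gcd (1 + j * r) m" using prime_factor_nat by blast
    hence q: "prime q" "q dvd 1 + j * r" "q dvd m" by (auto simp: gcd_greatest_iff)
    hence "q dvd p \<or> q dvd r" using m prime_dvd_mult_iff by blast
    hence "q dvd r" using q j(2) p(1) primes_dvd_imp_eq by blast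
    hence "q dvd j * r" by simp
    hence "q dvd 1" using q(2) by (metis dvd_add_left_iff)
    thus False using q by auto
  qed
  thus ?thesis using that[of j] j(1) p unfolding r_def by auto
qed

text \<open>Conjugation carries the relation to all primitive \<open>m\<close>-th roots. If
  \<open>p\<close> does not divide \<open>m\<close>, the congruence argument is applied with
  \<open>k = p\<close>, \<open>e = 1\<close>; otherwise with \<open>k = 1 + j * (m div p)\<close>,
  \<open>e = p\<close>, where \<open>z\<close> and \<open>z ^ k\<close> have the same
  \<open>p\<close>-th power.\<close>

lemma coincidence_of_power_relation:
  assumes p: "prime p" "p > 2" and m: "m > 0" and unit: "unit_mod p m (ev B)"
    and z: "z \<in> primroots m" and nz: "ev B z \<noteq> 0" "ev D z \<noteq> 0" and n: "n > 0"
    and rel: "ev A z ^ n * ev D z = ev B z ^ n * ev C z"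
    and M: "M \<ge> 1" "\<And>z. norm z = 1 \<Longrightarrow> norm (ev C z) \<le> M" "\<And>z. norm z = 1 \<Longrightarrow> norm (ev D z) \<le> M"
    and small: "(2 / real p) ^ n * M ^ (2 * p) < 1"
  shows "ev A z ^ p * ev B (z ^ p) = ev A (z ^ p) * ev B z ^ p \<or>
    (\<exists>w\<in>primroots p. ev A z ^ p * ev B (w * z) ^ p = ev A (w * z) ^ p * ev B z ^ p)"
proof -
  have p0: "p > 0" using p by simp
  have nz': "ev B y \<noteq> 0" "ev D y \<noteq> 0" if "y \<in> primroots m" for y
    using ev_primroots_conjugate[OF m that z] nz by blast+
  have rel': "ev A y ^ n * ev D y = ev B y ^ n * ev C y" if "y \<in> primroots m" for y
    using ev_primroots_conjugate[OF m z that, of "A ^ n * D - B ^ n * C"] rel by simp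
  have M': "norm (ev C y) \<le> M" "norm (ev D y) \<le> M" if "y \<in> primroots m" for y
    using M(2,3) primroots_norm[OF that m] by auto
  obtain U where U: "\<And>y. ev A y ^ p = ev A (y ^ p) + of_nat p * ev U y"
    using frobenius_ev[OF p(1), of A] by blast
  obtain W where W: "\<And>y. ev B y ^ p = ev B (y ^ p) + of_nat p * ev W y"
    using frobenius_ev[OF p(1), of B] by blast
  note main = congruence_imp_eq[OF m _ p0 _ n cyc_int_ev cyc_int_ev cyc_int_ev cyc_int_ev _ nz' rel'
      _ unit M(1) M' small z]
  show ?thesis
  proof (cases "p dvd m")
    case False
    hence cop: "coprime p m" using p(1) by (simp add: prime_imp_coprime)
    define F where "F = (\<lambda>y. ev U y * ev B (y ^ p) + (- ev A (y ^ p)) * ev W y)"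
    have "cyc_int m F" unfolding F_def
      by (intro cyc_int_add cyc_int_mult cyc_int_uminus cyc_int_ev cyc_int_compose_power[OF cyc_int_ev m cop])
    moreover have "ev A y ^ p * ev B (y ^ p) ^ 1 - ev A (y ^ p) ^ 1 * ev B y ^ p = of_nat p * F y" for y
      unfolding U W F_def by (simp add: algebra_simps)
    ultimately have "ev A z ^ p * ev B (z ^ p) ^ 1 = ev A (z ^ p) ^ 1 * ev B z ^ p"
      using p0 by (intro main[OF cop]) auto
    thus ?thesis by simp
  next
    case True
    obtain j where j: "0 < j" "j < p" "coprime (1 + j * (m div p)) m"
      by (rule ex_coprime_shift[OF p True m])
    define k where "k = 1 + j * (m div p)"
    have cop: "coprime k m" using j(3) by (simp add: k_def)
    have mp: "m = p * (m div p)" using True by simp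
    have km: "y ^ (k * p) = y ^ p" if "y \<in> primroots m" for y
    proof -
      have "k * p = p + (p * (m div p)) * j" by (simp only: k_def algebra_simps)
      hence "k * p = p + m * j" using mp by simp
      hence "y ^ (k * p) = y ^ p * (y ^ m) ^ j" by (simp only: power_add power_mult)
      thus ?thesis using that by (simp add: primroots_def)
    qed
    \<comment> \<open>After Frobenius expansion of all four \<open>p\<close>-th powers, the products
      of \<open>ev A (y ^ p)\<close> and \<open>ev B (y ^ p)\<close> cancel; \<open>F\<close> is the
      rest divided by \<open>p\<close>.\<close>
    define F where "F = (\<lambda>y. ev U y * ev B (y ^ p) + ev A (y ^ p) * ev W (y ^ k)
        + of_nat p * (ev U y * ev W (y ^ k)) + - (ev U (y ^ k) * ev B (y ^ p) + ev A (y ^ p) * ev W y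
        + of_nat p * (ev U (y ^ k) * ev W y)))"
    have comp_p: "cyc_int m (\<lambda>y. ev P (y ^ p))" for P
      unfolding cyc_int_def by (rule exI[of _ "pcompose P (monom 1 p)"]) simp
    have "cyc_int m F" unfolding F_def
      by (intro cyc_int_add cyc_int_mult cyc_int_uminus cyc_int_ev cyc_int_of_nat comp_p
            cyc_int_compose_power[OF cyc_int_ev m cop])
    moreover have "ev A y ^ p * ev B (y ^ k) ^ p - ev A (y ^ k) ^ p * ev B y ^ p = of_nat p * F y"
      if y: "y \<in> primroots m" for y
    proof -
      have [simp]: "(y ^ k) ^ p = y ^ p" using km[OF y] by (simp flip: power_mult)
      show ?thesis unfolding U W F_def by (simp add: algebra_simps)
    qed
    ultimately have eq: "ev A z ^ p * ev B (z ^ k) ^ p = ev A (z ^ k) ^ p * ev B z ^ p"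
      by (intro main[OF cop]) auto
    \<comment> \<open>The order of \<open>w\<close> is exactly \<open>p\<close> because
      \<open>0 < j < p\<close>.\<close>
    define w where "w = z ^ (j * (m div p))"
    have "w \<in> primroots p"
    proof -
      have "m div p > 0" using mp m by (metis mult_0_right neq0_conv)
      have "w ^ d = 1 \<longleftrightarrow> p dvd d" for d
      proof -
        have "w ^ d = 1 \<longleftrightarrow> m dvd (j * d) * (m div p)"
          using primroots_power_eq_1_iff[OF z m] by (simp add: w_def mult_ac flip: power_mult)
        also have "\<dots> \<longleftrightarrow> p dvd j * d"
          using \<open>m div p > 0\<close> by (subst mp) simp
        also have "\<dots> \<longleftrightarrow> p dvd d"
          using p(1) j by (auto simp: prime_dvd_mult_iff dest: dvd_imp_le)
        finally show ?thesis .
      qed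
      thus ?thesis unfolding primroots_def using nat_dvd_not_less by auto
    qed
    moreover have "z ^ k = w * z" by (simp add: k_def w_def power_add)
    ultimately show ?thesis using eq by auto
  qed
qed

text \<open>Two large primes are fixed before \<open>z\<close>, so that one of them makes
  \<open>B\<close> invertible as soon as the order of \<open>z\<close> does not divide
  \<open>N\<close>. Outside a finite set such a \<open>z\<close> with large \<open>n\<close>
  contradicts the finiteness of the coincidences.\<close>

lemma monomials_of_power_relation:
  assumes nz: "A \<noteq> 0" "B \<noteq> 0" "C \<noteq> 0" "D \<noteq> 0" and cop: "\<And>z. \<not> (ev A z = 0 \<and> ev B z = 0)"
    and inf: "\<And>N. infinite {z. root_of_unity z \<and>
        (\<exists>n\<ge>N. ev A z ^ n * ev D z = ev B z ^ n * ev C z)}"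
  shows "(\<exists>a k. A = monom a k) \<and> (\<exists>b l. B = monom b l)"
proof (rule ccontr)
  assume not_monom: "\<not> ?thesis"
  \<comment> \<open>A prime beyond \<open>L\<close> exceeds both degrees, cannot divide the leading
    coefficient of \<open>B\<close>, and has \<open>2 / p < 1\<close>, so that \<open>small\<close>
    holds for large \<open>n\<close>.\<close>
  define L where "L = 2 + degree A + degree B + nat \<bar>lead_coeff B\<bar>"
  obtain p1 where p1: "prime p1" "p1 > L" using bigger_prime by blast
  obtain p2 where p2: "prime p2" "p2 > p1" using bigger_prime by blast
  have lead: "\<not> int p dvd lead_coeff B" if "p > L" for p
  proof
    assume "int p dvd lead_coeff B"
    hence "int p \<le> \<bar>lead_coeff B\<bar>" using nz(2) by (simp add: zdvd_imp_le dvd_abs_iff)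
    thus False using that by (simp add: L_def)
  qed
  have deg: "p > 2" "degree A < p" "degree B < p" if "p > L" for p
    using that by (auto simp: L_def)
  obtain N where N: "N > 0" "\<And>m. m > 0 \<Longrightarrow> \<not> m dvd N \<Longrightarrow> unit_mod p1 m (ev B) \<or> unit_mod p2 m (ev B)"
    using unit_mod_or_bounded_order[of p1 p2 B] p1 p2 lead by (metis less_irrefl less_trans)
  obtain M1 where M1: "M1 \<ge> 1" "\<And>z. norm z = 1 \<Longrightarrow> norm (ev C z) \<le> M1" 
    using ev_bounded_unit_circle[of C] by blast
  obtain M2 where M2: "M2 \<ge> 1" "\<And>z. norm z = 1 \<Longrightarrow> norm (ev D z) \<le> M2"
    using ev_bounded_unit_circle[of D] by blast
  define M where "M = max M1 M2"
  have M: "M \<ge> 1" "\<And>z. norm z = 1 \<Longrightarrow> norm (ev C z) \<le> M" "\<And>z. norm z = 1 \<Longrightarrow> norm (ev D z) \<le> M"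
    using M1 M2 by (auto simp: M_def max.coboundedI1 max.coboundedI2)
  have small: "eventually (\<lambda>n. (2 / real p) ^ n * M ^ (2 * p) < 1) sequentially" if "p > L" for p
  proof -
    have "(\<lambda>n. (2 / real p) ^ n * M ^ (2 * p)) \<longlonglongrightarrow> 0 * M ^ (2 * p)"
      using deg(1)[OF that] by (intro tendsto_mult tendsto_const LIMSEQ_power_zero) simp
    thus ?thesis by (intro order_tendstoD(2)) auto
  qed
  have pL: "p1 > L" "p2 > L" using p1 p2 by auto
  have "eventually (\<lambda>n. n > 0 \<and> (2 / real p1) ^ n * M ^ (2 * p1) < 1 \<and> (2 / real p2) ^ n * M ^ (2 * p2) < 1) sequentially"
    by (intro eventually_conj eventually_gt_at_top small pL)
  then obtain N0 where N0: "\<And>n. n \<ge> N0 \<Longrightarrow> n > 0 \<and> (2 / real p1) ^ n * M ^ (2 * p1) < 1 \<and>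
      (2 / real p2) ^ n * M ^ (2 * p2) < 1"
    unfolding eventually_sequentially by blast
  define X where "X = (\<lambda>p. {z. ev A z ^ p * ev B (z ^ p) = ev A (z ^ p) * ev B z ^ p} \<union>
    (\<Union>w\<in>primroots p. {z. ev A z ^ p * ev B (w * z) ^ p = ev A (w * z) ^ p * ev B z ^ p}))"
  have X: "finite (X p)" if "p > L" for p
    unfolding X_def using deg[OF that]
    by (intro finite_UnI finite_UN_I finite_primroots finite_frobenius_coincidence
          finite_rotation_coincidence nz cop not_monom) auto
  \<comment> \<open>Excluded are the coincidences for both primes, the zeros of \<open>B\<close> and
    \<open>D\<close>, and the roots of unity of order dividing \<open>N\<close>.\<close>
  define F where "F = X p1 \<union> X p2 \<union> {z. ev B z = 0} \<union> {z. ev D z = 0} \<union> {z. z ^ N = 1}"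
  have "finite F"
    unfolding F_def using N(1) by (intro finite_UnI X pL finite_ev_roots nz finite_roots_unity) auto
  from Diff_infinite_finite[OF this inf[of N0]]
  obtain z where "z \<notin> F" and z_root: "root_of_unity z"
    and z_ex: "\<exists>n\<ge>N0. ev A z ^ n * ev D z = ev B z ^ n * ev C z"
    using infinite_imp_nonempty by blast
  hence z: "z \<notin> X p1" "z \<notin> X p2" "ev B z \<noteq> 0" "ev D z \<noteq> 0" "z ^ N \<noteq> 1"
    by (simp_all add: F_def)
  obtain n where n: "n \<ge> N0" "ev A z ^ n * ev D z = ev B z ^ n * ev C z" using z_ex by blast
  obtain m where m: "m > 0" "z \<in> primroots m"
    using z_root ex_primroots unfolding root_of_unity_def by metis
  have "\<not> m dvd N" using primroots_power_eq_1_iff[OF m(2,1)] z(5) by simp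
  hence "unit_mod p1 m (ev B) \<or> unit_mod p2 m (ev B)" using N(2) m(1) by blast
  moreover have False if "unit_mod p m (ev B)" "p > L" "prime p" "z \<notin> X p"
      "(2 / real p) ^ n * M ^ (2 * p) < 1" for p
    using coincidence_of_power_relation[OF that(3) deg(1)[OF that(2)] m(1) that(1) m(2) z(3,4) _ n(2) M that(5)]
      N0[OF n(1)] that(4) unfolding X_def by blast
  ultimately show False using pL p1 p2 z(1,2) N0[OF n(1)] by blast
qed

text \<open>On the unit circle monomials have constant modulus. If \<open>\<bar>a\<bar>\<close> were
  larger, the relation for large \<open>n\<close> would force \<open>D\<close> to have modulus below
  1 at all conjugates of \<open>z\<close>, hence to vanish there.\<close>

lemma monom_coeff_le:
  assumes nz: "b \<noteq> 0" "D \<noteq> 0"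
    and inf: "\<And>N. infinite {z. root_of_unity z \<and>
        (\<exists>n\<ge>N. ev (monom a k) z ^ n * ev D z = ev (monom b l) z ^ n * ev C z)}"
  shows "\<bar>a\<bar> \<le> \<bar>b\<bar>"
proof (rule ccontr)
  assume less: "\<not> \<bar>a\<bar> \<le> \<bar>b\<bar>"
  define x where "x = real_of_int \<bar>a\<bar> / real_of_int \<bar>b\<bar>"
  have "x > 1" using less nz(1) by (simp add: x_def)
  obtain M where M: "M \<ge> 1" "\<And>z. norm z = 1 \<Longrightarrow> norm (ev C z) \<le> M" 
    using ev_bounded_unit_circle[of C] by blast
  obtain N where N: "x ^ N > M" using real_arch_pow[OF \<open>x > 1\<close>] by blast
  from Diff_infinite_finite[OF finite_ev_roots[OF nz(2)] inf[of N]]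
  obtain z where z: "ev D z \<noteq> 0" "root_of_unity z"
    and "\<exists>n\<ge>N. ev (monom a k) z ^ n * ev D z = ev (monom b l) z ^ n * ev C z"
    using infinite_imp_nonempty by blast
  then obtain n where n: "n \<ge> N" "ev (monom a k ^ n * D - monom b l ^ n * C) z = 0"
    by auto
  obtain m where m: "m > 0" "z \<in> primroots m"
    using z(2) ex_primroots unfolding root_of_unity_def by metis
  have "norm (ev D y) < 1" if y: "y \<in> primroots m" for y
  proof -
    have y1: "norm y = 1" using primroots_norm[OF y m(1)] .
    have "ev (monom a k) y ^ n * ev D y = ev (monom b l) y ^ n * ev C y"
      using ev_primroots_conjugate[OF m(1) m(2) y n(2)] by simp
    from arg_cong[OF this, of norm]
    have "real_of_int \<bar>a\<bar> ^ n * norm (ev D y) = real_of_int \<bar>b\<bar> ^ n * norm (ev C y)"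
      by (simp add: norm_mult norm_power y1)
    hence "x ^ n * norm (ev D y) = norm (ev C y)"
      using nz(1) by (simp add: x_def power_divide field_simps)
    also have "\<dots> \<le> M" using M(2) y1 by blast
    also have "\<dots> < x ^ N" by (rule N)
    also have "\<dots> \<le> x ^ n" using n(1) \<open>x > 1\<close> by (intro power_increasing) auto
    finally show ?thesis using \<open>x > 1\<close> by simp
  qed
  hence "ev D z = 0"
    using almost_int_eq_0[OF m(1) cyc_int_imp_almost_int[OF cyc_int_ev]] m(2) by blast
  thus False using z(1) by contradiction
qed

theorem power_relation_imp_monomials:
  assumes nz: "A \<noteq> 0" "B \<noteq> 0" "C \<noteq> 0" "D \<noteq> 0" and cop: "\<And>z. \<not> (ev A z = 0 \<and> ev B z = 0)"
    and inf: "\<And>N. infinite {z. root_of_unity z \<and>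
        (\<exists>n\<ge>N. ev A z ^ n * ev D z = ev B z ^ n * ev C z)}"
  obtains a k b l where "A = monom a k" "B = monom b l" "\<bar>a\<bar> = \<bar>b\<bar>" "a \<noteq> 0"
proof -
  obtain a k b l where AB: "A = monom a k" "B = monom b l"
    using monomials_of_power_relation[OF assms] by blast
  have ab: "a \<noteq> 0" "b \<noteq> 0" using nz AB by auto
  have "\<bar>a\<bar> \<le> \<bar>b\<bar>"
    by (rule monom_coeff_le[OF ab(2) nz(4) inf[unfolded AB]])
  \<comment> \<open>The relation is symmetric under exchanging \<open>A\<close> with
    \<open>B\<close> and \<open>D\<close> with \<open>C\<close>, which gives the reverse
    inequality.\<close>
  moreover have "infinite {z. root_of_unity z \<and>
        (\<exists>n\<ge>N. ev (monom b l) z ^ n * ev C z = ev (monom a k) z ^ n * ev D z)}" for N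
  proof -
    have "ev (monom b l) z ^ n * ev C z = ev (monom a k) z ^ n * ev D z \<longleftrightarrow>
        ev (monom a k) z ^ n * ev D z = ev (monom b l) z ^ n * ev C z" for z n
      by (rule eq_commute)
    thus ?thesis using inf[of N] unfolding AB by (simp only: not_False_eq_True)
  qed
  hence "\<bar>b\<bar> \<le> \<bar>a\<bar>" by (rule monom_coeff_le[OF ab(1) nz(3)])
  ultimately show ?thesis using AB ab(1) that by simp
qed

subsection \<open>Rational polynomials\<close>

lemma cpoly_pCons [simp]: "cpoly (pCons a p) z = of_rat a + z * cpoly p z"
  by (simp add: map_poly_pCons)

lemma cpoly_add [simp]: "cpoly (p + q) z = cpoly p z + cpoly q z"
  by (induction p q rule: poly_induct2) (auto simp: algebra_simps of_rat_add)

lemma cpoly_smult [simp]: "cpoly (smult a p) z = of_rat a * cpoly p z"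
  by (induction p) (auto simp: algebra_simps of_rat_mult)

lemma cpoly_uminus [simp]: "cpoly (- p) z = - cpoly p z"
  using cpoly_smult[of "-1" p z] by (simp add: of_rat_minus)

lemma cpoly_mult [simp]: "cpoly (p * q) z = cpoly p z * cpoly q z"
  by (induction p) (auto simp: algebra_simps)

lemma cpoly_power [simp]: "cpoly (p ^ n) z = cpoly p z ^ n"
  by (induction n) auto

lemma cpoly_monom [simp]: "cpoly (monom a n) z = of_rat a * z ^ n"
  by (simp add: map_poly_monom poly_monom)

lemma finite_cpoly_roots:
  assumes "p \<noteq> 0"
  shows "finite {z. cpoly p z = 0}"
proof -
  have "map_poly of_rat p \<noteq> (0 :: complex poly)"
    using assms by (simp add: map_poly_eq_0_iff)
  thus ?thesis by (rule poly_roots_finite)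
qed

section \<open>Passage from rational to integer polynomials\<close>

abbreviation rat_of_int_poly :: "int poly \<Rightarrow> rat poly" where
  "rat_of_int_poly \<equiv> map_poly of_int"

lemma cpoly_rat_of_int_poly [simp]: "cpoly (rat_of_int_poly P) z = ev P z"
  by (induction P) (auto simp: map_poly_pCons)

lemma smult_rat_of_int_poly: "rat_of_int_poly (smult c P) = smult (of_int c) (rat_of_int_poly P)"
  by (rule poly_eqI) (simp add: coeff_map_poly)

lemma rat_of_int_poly_mult: "rat_of_int_poly (P * Q) = rat_of_int_poly P * rat_of_int_poly Q"
proof (induction P)
  case (pCons a P)
  have "rat_of_int_poly (R + T) = rat_of_int_poly R + rat_of_int_poly T" for R T :: "int poly"
    by (rule poly_eqI) (simp add: coeff_map_poly)
  thus ?case using pCons.IH by (simp add: map_poly_pCons smult_rat_of_int_poly)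
qed simp

lemma ex_common_denominator:
  fixes p :: "rat poly"
  obtains c P where "c \<noteq> 0" "smult (of_int c) p = rat_of_int_poly P"
proof -
  have "\<exists>c P. c \<noteq> 0 \<and> smult (of_int c) p = rat_of_int_poly P"
  proof (induction p)
    case 0
    show ?case by (intro exI[of _ 1] exI[of _ 0]) simp
  next
    case (pCons a p)
    then obtain c P where cP: "c \<noteq> 0" "smult (of_int c) p = rat_of_int_poly P" by blast
    obtain x y where xy: "quotient_of a = (x, y)" by fastforce
    have a: "a = of_int x / of_int y" "y > 0"
      using quotient_of_div[OF xy] quotient_of_denom_pos[OF xy] by auto
    have "smult (of_int (y * c)) (pCons a p) = pCons (of_int (x * c)) (smult (of_int y) (smult (of_int c) p))"
      using a by simp
    also have "\<dots> = rat_of_int_poly (pCons (x * c) (smult y P))"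
      unfolding cP(2) by (simp add: map_poly_pCons smult_rat_of_int_poly)
    finally have "smult (of_int (y * c)) (pCons a p) = rat_of_int_poly (pCons (x * c) (smult y P))" .
    thus ?case using cP(1) a(2) by (intro exI[of _ "y * c"] exI) auto
  qed
  thus ?thesis using that by blast
qed

lemma ex_common_denominator2:
  fixes p q :: "rat poly"
  obtains c P Q where "c \<noteq> 0" "smult (of_int c) p = rat_of_int_poly P"
    "smult (of_int c) q = rat_of_int_poly Q"
proof -
  obtain c P where 1: "c \<noteq> 0" "smult (of_int c) p = rat_of_int_poly P" by (rule ex_common_denominator)
  obtain d Q where 2: "d \<noteq> 0" "smult (of_int d) q = rat_of_int_poly Q" by (rule ex_common_denominator)
  have "smult (of_int (c * d)) p = rat_of_int_poly (smult d P)"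
    unfolding smult_rat_of_int_poly 1(2)[symmetric] by (simp add: mult.commute)
  moreover have "smult (of_int (c * d)) q = rat_of_int_poly (smult c Q)"
    unfolding smult_rat_of_int_poly 2(2)[symmetric] by simp
  moreover have "c * d \<noteq> 0" using 1 2 by simp
  ultimately show ?thesis using that by blast
qed

text \<open>Clear denominators and divide by the gcd over the integers; at a common root the minimal
  polynomial would be a non-constant common divisor of the coprime \<open>A\<close> and
  \<open>B\<close>.\<close>

lemma ex_coprime_int_ratio:
  fixes f1 f2 :: "rat poly"
  assumes "f1 \<noteq> 0" "f2 \<noteq> 0"
  obtains g A B where "g \<noteq> 0" "f1 = g * rat_of_int_poly B" "f2 = g * rat_of_int_poly A"
    "\<forall>z. \<not> (ev A z = 0 \<and> ev B z = 0)"
proof -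
  obtain c P1 P2 where c: "c \<noteq> 0" "smult (of_int c) f1 = rat_of_int_poly P1"
    "smult (of_int c) f2 = rat_of_int_poly P2"
    by (rule ex_common_denominator2)
  have P0: "P1 \<noteq> 0" "P2 \<noteq> 0" using c assms by auto
  define G where "G = gcd P1 P2"
  have "G \<noteq> 0" using P0 by (simp add: G_def)
  then obtain B A where AB: "P1 = B * G" "P2 = A * G" "coprime B A"
    using gcd_coprime_exists[of P1 P2] unfolding G_def by blast
  have "\<not> (ev A z = 0 \<and> ev B z = 0)" for z
  proof
    assume z: "ev A z = 0 \<and> ev B z = 0"
    have "A \<noteq> 0" using AB(2) P0 by auto
    obtain f where "f \<noteq> 0" "ev f z = 0" and deg: "degree f > 0"
      and "\<And>P. ev P z = 0 \<Longrightarrow> degree P < degree f \<Longrightarrow> P = 0"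
      and dvd: "\<And>P. ev P z = 0 \<Longrightarrow> f dvd P"
      using ex_minimal_int_poly[OF \<open>A \<noteq> 0\<close> conjunct1[OF z]] by blast
    have "is_unit f" using dvd z AB(3) coprime_common_divisor by blast
    hence "degree f = 0" using dvd_imp_degree_le[of f 1] by simp
    thus False using deg by simp
  qed
  moreover define g where "g = smult (1 / of_int c) (rat_of_int_poly G)"
  have "f1 = smult (1 / of_int c) (smult (of_int c) f1)" "f2 = smult (1 / of_int c) (smult (of_int c) f2)"
    using c(1) by simp_all
  hence "f1 = g * rat_of_int_poly B" "f2 = g * rat_of_int_poly A"
    unfolding c(2,3) AB(1,2) g_def rat_of_int_poly_mult by (simp_all add: mult.commute)
  moreover have "g \<noteq> 0" using \<open>f1 = g * _\<close> assms by auto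
  ultimately show ?thesis using that by blast
qed

text \<open>After discarding the finitely many zeros of the common factor \<open>g\<close>, the
  integer theorem applies to \<open>A / B\<close>. Keeping powers of \<open>x\<close> on both sides
  avoids negative exponents.\<close>

lemma ratio_eq_monomial:
  fixes f1 f2 d1 d2 :: "rat poly"
  assumes nz: "f1 \<noteq> 0" "f2 \<noteq> 0" "d1 \<noteq> 0" "d2 \<noteq> 0"
    and inf: "\<And>N. infinite {z. root_of_unity z \<and>
      (\<exists>n\<ge>N. cpoly f2 z ^ n * cpoly d2 z = cpoly f1 z ^ n * cpoly d1 z)}"
  obtains e k l where "e \<in> {1, -1}" "f2 * monom 1 l = f1 * monom e k"
proof -
  obtain g A B where g: "g \<noteq> 0" "f1 = g * rat_of_int_poly B" "f2 = g * rat_of_int_poly A"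
    "\<forall>z. \<not> (ev A z = 0 \<and> ev B z = 0)"
    by (rule ex_coprime_int_ratio[OF nz(1,2)])
  obtain c D C where c: "c \<noteq> 0" "smult (of_int c) d2 = rat_of_int_poly D"
    "smult (of_int c) d1 = rat_of_int_poly C" by (rule ex_common_denominator2)
  have nz': "A \<noteq> 0" "B \<noteq> 0" "C \<noteq> 0" "D \<noteq> 0"
    using nz g c by auto
  have DC: "ev D z = of_int c * cpoly d2 z" "ev C z = of_int c * cpoly d1 z" for z
    using arg_cong[OF c(2), of "\<lambda>p. cpoly p z"] arg_cong[OF c(3), of "\<lambda>p. cpoly p z"] by simp_all
  have "infinite {z. root_of_unity z \<and> (\<exists>n\<ge>N. ev A z ^ n * ev D z = ev B z ^ n * ev C z)}" for N
  proof (rule infinite_super[OF _ Diff_infinite_finite[OF finite_cpoly_roots[OF g(1)] inf[of N]]])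
    have "ev A z ^ n * ev D z = ev B z ^ n * ev C z"
      if "cpoly f2 z ^ n * cpoly d2 z = cpoly f1 z ^ n * cpoly d1 z" "cpoly g z \<noteq> 0" for z n
    proof -
      have "cpoly g z ^ n * (ev A z ^ n * cpoly d2 z) = cpoly g z ^ n * (ev B z ^ n * cpoly d1 z)"
        using that(1) unfolding g(2,3) by (simp add: power_mult_distrib mult_ac)
      hence "ev A z ^ n * cpoly d2 z = ev B z ^ n * cpoly d1 z" using that(2) by simp
      thus ?thesis unfolding DC by (simp add: mult_ac)
    qed
    thus "{z. root_of_unity z \<and> (\<exists>n\<ge>N. cpoly f2 z ^ n * cpoly d2 z = cpoly f1 z ^ n * cpoly d1 z)}
        - {z. cpoly g z = 0}
      \<subseteq> {z. root_of_unity z \<and> (\<exists>n\<ge>N. ev A z ^ n * ev D z = ev B z ^ n * ev C z)}"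
      by blast
  qed
  from power_relation_imp_monomials[OF nz' g(4)[rule_format] this]
  obtain a k b l where ab: "A = monom a k" "B = monom b l" "\<bar>a\<bar> = \<bar>b\<bar>" "a \<noteq> 0" by blast
  define e :: int where "e = (if a = b then 1 else -1)"
  have a: "a = e * b" using ab(3) by (auto simp: e_def abs_eq_iff)
  have "f2 * monom 1 l = f1 * monom (of_int e) k"
    unfolding g(2,3) ab a by (simp add: map_poly_monom mult_monom mult.assoc add.commute mult.commute)
  moreover have "of_int e \<in> {1, -1 :: rat}" by (auto simp: e_def)
  ultimately show ?thesis using that by blast
qed

subsection \<open>Binomial recurrences\<close>

lemma fract_eq_monomial_iff:
  fixes c1 c2 :: "rat poly"
  assumes "c1 \<noteq> 0"
  shows "to_fract c2 / to_fract c1 = to_fract [:d:] * rat_fun_X powi (int k - int l) \<longleftrightarrow>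
    c2 * monom 1 l = c1 * monom d k"
proof -
  have X0: "rat_fun_X \<noteq> 0" by (simp add: to_fract_eq_0_iff)
  have pow: "to_fract (monom 1 n) = rat_fun_X ^ n" for n
    proof (induction n)
    case (Suc n)
    have "monom 1 (Suc n) = [:0, 1:] * monom (1::rat) n" by (simp add: monom_Suc)
    thus ?case using Suc by (simp only: to_fract_mult power_Suc)
  qed simp
  have "monom d k = [:d:] * monom 1 k" by (simp add: smult_monom)
  hence mon: "to_fract (monom d k) = to_fract [:d:] * rat_fun_X ^ k" by (simp only: to_fract_mult pow)
  have "rat_fun_X powi (int k - int l) = rat_fun_X ^ k / rat_fun_X ^ l"
    using X0 by (simp add: power_int_diff)
  moreover have "p / q = s * (u / v) \<longleftrightarrow> p * v = q * (s * u)" if "q \<noteq> 0" "v \<noteq> 0"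
    for p q s u v :: "rat poly fract"
    using that by (simp add: field_simps)
  ultimately have "to_fract c2 / to_fract c1 = to_fract [:d:] * rat_fun_X powi (int k - int l) \<longleftrightarrow>
      to_fract c2 * rat_fun_X ^ l = to_fract c1 * (to_fract [:d:] * rat_fun_X ^ k)"
    using X0 assms by simp
  also have "\<dots> \<longleftrightarrow> to_fract (c2 * monom 1 l) = to_fract (c1 * monom d k)"
    by (simp only: to_fract_mult pow mon)
  finally show ?thesis by (simp only: to_fract_eq_iff)
qed

lemma cpoly_eq_of_fract_eq:
  fixes c1 c2 :: "rat poly"
  assumes "c1 \<noteq> 0" "to_fract c2 / to_fract c1 = to_fract [:d:] * rat_fun_X powi a" "z \<noteq> 0"
  shows "cpoly c2 z = of_rat d * cpoly c1 z * z powi a"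
proof -
  have a: "a = int (nat a) - int (nat (- a))" by simp
  have "c2 * monom 1 (nat (- a)) = c1 * monom d (nat a)"
    using assms(2) by (subst (asm) a) (simp only: fract_eq_monomial_iff[OF assms(1)])
  from arg_cong[OF this, of "\<lambda>p. cpoly p z"]
  have "cpoly c2 z * z ^ nat (- a) = of_rat d * cpoly c1 z * z ^ nat a" by simp
  hence "cpoly c2 z = of_rat d * cpoly c1 z * (z ^ nat a / z ^ nat (- a))"
    using assms(3) by (simp add: field_simps)
  moreover have "z powi a = z ^ nat a / z ^ nat (- a)"
    using power_int_diff[of z "int (nat a)" "int (nat (- a))"] assms(3) unfolding a[symmetric]
    by (simp only: power_int_of_nat) simp
  ultimately show ?thesis by (simp only:)
qed

section \<open>Monomial ratios produce infinitely many zeros\<close>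

lemma powi_eq_sign_iff:
  fixes z :: complex
  assumes "s \<in> {1, -1}"
  shows "z powi h = s \<longleftrightarrow> z ^ nat \<bar>h\<bar> = s"
proof (cases "h \<ge> 0")
  case False
  have "inverse s = s" using assms by auto
  hence "inverse (z ^ nat (- h)) = s \<longleftrightarrow> z ^ nat (- h) = s"
    by (metis inverse_inverse_eq)
  thus ?thesis using False by (simp add: power_int_def power_inverse)
qed (simp add: power_int_def)

text \<open>Even indices \<open>2 * t\<close> remove the sign \<open>e\<close>. Away from 0 and the
  zeros of \<open>c1\<close> and \<open>f1\<close>, vanishing then means
  \<open>z ^ h t = - d\<close>, which has a solution on the unit circle whose angle shrinks as
  \<open>t\<close> grows.\<close>

lemma infinite_zeros_if_monomial_ratios:
  fixes c1 c2 f1 f2 :: "rat poly"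
  assumes nz: "c1 \<noteq> 0" "f1 \<noteq> 0" and b: "b \<noteq> 0" and d: "d \<in> {1, -1}" and e: "e \<in> {1, -1}"
    and c: "to_fract c2 / to_fract c1 = to_fract [:d:] * rat_fun_X powi a"
    and f: "to_fract f2 / to_fract f1 = to_fract [:e:] * rat_fun_X powi b"
  shows "infinite {\<zeta>::complex. root_of_unity \<zeta> \<and>
            (\<exists>n::nat. n > 0 \<and> u_poly c1 c2 f1 f2 n \<noteq> 0 \<and> cpoly (u_poly c1 c2 f1 f2 n) \<zeta> = 0)}"
    (is "infinite ?S")
proof -
  define h where "h = (\<lambda>t::nat. nat \<bar>a + b * int (2 * t)\<bar>)"
  define s :: complex where "s = - of_rat d"
  have s: "s \<in> {1, -1}" using d by (auto simp: s_def)
  have u: "cpoly (u_poly c1 c2 f1 f2 (2 * t)) z = 0 \<longleftrightarrow> cpoly c1 z = 0 \<or> cpoly f1 z = 0 \<or> z ^ h t = s"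
    if z: "z \<noteq> 0" "t > 0" for z t
  proof -
    have "of_rat e ^ (2 * t) = (1 :: complex)" using e by (auto simp: of_rat_minus)
    hence "cpoly f2 z ^ (2 * t) = cpoly f1 z ^ (2 * t) * z powi (b * int (2 * t))"
      using cpoly_eq_of_fract_eq[OF nz(2) f z(1)]
      by (simp add: power_mult_distrib power_int_power' mult.commute del: power_mult)
    hence "cpoly (u_poly c1 c2 f1 f2 (2 * t)) z =
      cpoly c1 z * cpoly f1 z ^ (2 * t) * (1 + of_rat d * (z powi a * z powi (b * int (2 * t))))"
      using cpoly_eq_of_fract_eq[OF nz(1) c z(1)] by (simp add: u_poly_def algebra_simps)
    also have "z powi a * z powi (b * int (2 * t)) = z powi (a + b * int (2 * t))"
      using z(1) by (simp add: power_int_add)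
    finally have "cpoly (u_poly c1 c2 f1 f2 (2 * t)) z =
      cpoly c1 z * cpoly f1 z ^ (2 * t) * (1 + of_rat d * z powi (a + b * int (2 * t)))" .
    moreover have "1 + of_rat d * w = 0 \<longleftrightarrow> w = s" for w :: complex
    proof -
      have "d = 1 \<or> d = -1" using d by blast
      thus ?thesis
      proof
        assume "d = 1"
        thus ?thesis by (simp add: s_def add_eq_0_iff)
      next
        assume "d = -1"
        thus ?thesis by (simp add: s_def of_rat_minus)
      qed
    qed
    ultimately show ?thesis using z(2) powi_eq_sign_iff[OF s] unfolding h_def
      by (simp only: mult_eq_0_iff power_eq_0_iff) auto
  qed
  \<comment> \<open>Beyond this threshold \<open>a + 2 * b * t\<close> has the sign of
    \<open>b\<close>, so \<open>h\<close> is injective, and \<open>h t \<ge> 2\<close>.\<close>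
  define T where "T = {t. t > nat \<bar>a\<bar> + 1}"
  have lin: "int (h t) = sgn b * a + 2 * \<bar>b\<bar> * int t" "h t \<ge> 2" "t > 0" if "t \<in> T" for t
  proof -
    have t: "int t > \<bar>a\<bar> + 1" "t > 0" using that by (auto simp: T_def)
    have bt: "\<bar>b\<bar> * int t \<ge> 1 * int t" using b by (intro mult_right_mono) auto
    have ht: "int (h t) = \<bar>a + 2 * (b * int t)\<bar>" by (simp add: h_def algebra_simps)
    consider "b > 0" | "b < 0" using b by linarith
    thus "int (h t) = sgn b * a + 2 * \<bar>b\<bar> * int t"
    proof cases
      case 1
      hence "a + 2 * (b * int t) \<ge> 0" using t(1) bt by simp
      thus ?thesis unfolding ht using 1 by simp
    next
      case 2
      hence "a + 2 * (b * int t) \<le> 0" using t(1) bt by simp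
      thus ?thesis unfolding ht using 2 by simp
    qed
    moreover have "sgn b * a \<ge> - \<bar>a\<bar>" by (cases b "0::int" rule: linorder_cases) (use b in auto)
    ultimately show "h t \<ge> 2" using t bt by linarith
    show "t > 0" by fact
  qed
  \<comment> \<open>An argument of \<open>s\<close>, taken as \<open>2 * pi\<close> rather than 0
    for \<open>s = 1\<close>, so that distinct \<open>h t\<close> give distinct angles. Since
    \<open>h t \<ge> 2\<close> these lie in the interval from 0 to \<open>pi\<close>, where the
    cosine is injective.\<close>
  define \<theta> where "\<theta> = (if s = 1 then 2 * pi else pi)"
  have \<theta>: "\<theta> > 0" "\<theta> \<le> 2 * pi" "cis \<theta> = s" using s by (auto simp: \<theta>_def)
  define \<zeta> where "\<zeta> = (\<lambda>t. cis (\<theta> / real (h t)))"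
  have \<zeta>: "\<zeta> t ^ h t = s" if "t \<in> T" for t
  proof -
    have "\<zeta> t ^ h t = cis (real (h t) * (\<theta> / real (h t)))"
      unfolding \<zeta>_def by (rule Complex.DeMoivre)
    also have "real (h t) * (\<theta> / real (h t)) = \<theta>" using lin(2)[OF that] by simp
    finally show ?thesis using \<theta>(3) by simp
  qed
  have "inj_on \<zeta> T"
  proof (rule inj_onI)
    fix t t' assume t: "t \<in> T" "t' \<in> T" "\<zeta> t = \<zeta> t'"
    have range: "0 \<le> \<theta> / real (h t)" "\<theta> / real (h t) \<le> pi" if "t \<in> T" for t
    proof -
      show "0 \<le> \<theta> / real (h t)" using \<theta>(1) by simp
      have "\<theta> \<le> pi * 2" using \<theta>(2) by simp
      also have "\<dots> \<le> pi * real (h t)" using lin(2)[OF that] by (intro mult_left_mono) auto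
      finally show "\<theta> / real (h t) \<le> pi" using lin(2)[OF that] by (simp add: pos_divide_le_eq)
    qed
    have "cos (\<theta> / real (h t)) = cos (\<theta> / real (h t'))"
      using arg_cong[OF t(3), of Re] by (simp add: \<zeta>_def)
    hence "\<theta> / real (h t) = \<theta> / real (h t')"
      by (rule cos_inj_pi[OF range[OF t(1)] range[OF t(2)]])
    moreover have "h t \<noteq> 0" "h t' \<noteq> 0" using lin(2)[OF t(1)] lin(2)[OF t(2)] by auto
    ultimately have "h t = h t'" using \<theta>(1) by (simp add: frac_eq_eq)
    hence "sgn b * a + 2 * \<bar>b\<bar> * int t = sgn b * a + 2 * \<bar>b\<bar> * int t'"
      unfolding lin(1)[OF t(1), symmetric] lin(1)[OF t(2), symmetric] by simp
    thus "t = t'" using b by simp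
  qed
  moreover have "infinite T" unfolding T_def unfolding greaterThan_def[symmetric] by (rule infinite_Ioi)
  ultimately have "infinite (\<zeta> ` T)" using finite_imageD by blast
  moreover have "\<zeta> ` T \<subseteq> ?S"
  proof
    fix z assume "z \<in> \<zeta> ` T"
    then obtain t where t: "t \<in> T" "z = \<zeta> t" by blast
    note t_lin = lin[OF t(1)]
    have "z ^ (2 * h t) = (z ^ h t) ^ 2" by (simp add: mult.commute power_mult)
    also have "\<dots> = 1" using \<zeta>[OF t(1)] s t(2) by auto
    finally have "root_of_unity z" unfolding root_of_unity_def using t_lin by (intro exI[of _ "2 * h t"]) auto
    moreover have "cpoly (u_poly c1 c2 f1 f2 (2 * t)) z = 0"
    proof -
      have "z \<noteq> 0" unfolding t(2) \<zeta>_def by simp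
      thus ?thesis using u[OF _ t_lin(3), of z] \<zeta>[OF t(1)] t(2) by simp
    qed
    moreover have "u_poly c1 c2 f1 f2 (2 * t) \<noteq> 0"
    proof
      assume u0: "u_poly c1 c2 f1 f2 (2 * t) = 0"
      \<comment> \<open>Integers from 2 on lie outside the unit circle; if the polynomial were zero,
        one of them avoiding the zeros of \<open>c1\<close> and \<open>f1\<close> would have a
        positive power of modulus 1.\<close>
      have "infinite ((\<lambda>j. of_nat (j + 2) :: complex) ` UNIV)"
        using finite_imageD[of "\<lambda>j. of_nat (j + 2) :: complex" UNIV] by (auto simp: inj_def)
      hence "infinite ((\<lambda>j. of_nat (j + 2) :: complex) ` UNIV - ({z. cpoly c1 z = 0} \<union> {z. cpoly f1 z = 0}))"
        using nz by (intro Diff_infinite_finite finite_UnI finite_cpoly_roots)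
      then obtain j where j: "cpoly c1 (of_nat (j + 2)) \<noteq> 0" "cpoly f1 (of_nat (j + 2)) \<noteq> 0"
        using infinite_imp_nonempty by blast
      define y :: complex where "y = of_nat (j + 2)"
      have y: "norm y = real (j + 2)" unfolding y_def by (rule norm_of_nat)
      hence "y \<noteq> 0" by auto
      hence "y ^ h t = s"
        using u[OF _ t_lin(3), of y] j u0 unfolding y_def by simp
      hence "norm (y ^ h t) = 1" using s by auto
      hence "real (j + 2) ^ h t = 1" by (simp only: norm_power y)
      moreover have "real (j + 2) ^ h t > 1" using t_lin(2) by (intro one_less_power) auto
      ultimately show False by simp
    qed
    ultimately show "z \<in> ?S" using t_lin(3) by (intro CollectI conjI exI[of _ "2 * t"]) simp_all
  qed
  ultimately show ?thesis using infinite_super by blast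
qed

text \<open>The monomial theorem is used twice: first for \<open>f2 / f1\<close> with unbounded
  index \<open>n\<close>, then for \<open>c2 / c1\<close>, whose values at the zeros in question are
  roots of unity. Equal exponents \<open>k = l\<close> would leave only finitely many zeros.\<close>

lemma monomial_ratios_if_infinite_zeros:
  fixes c1 c2 f1 f2 :: "rat poly"
  assumes nz: "c1 \<noteq> 0" "c2 \<noteq> 0" "f1 \<noteq> 0" "f2 \<noteq> 0"
    and inf: "infinite {\<zeta>::complex. root_of_unity \<zeta> \<and>
            (\<exists>n::nat. n > 0 \<and> u_poly c1 c2 f1 f2 n \<noteq> 0 \<and> cpoly (u_poly c1 c2 f1 f2 n) \<zeta> = 0)}"
      (is "infinite ?S")
  obtains d e k l k' l' where "d \<in> {1, -1}" "e \<in> {1, -1}" "k \<noteq> l"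
    "c2 * monom 1 l' = c1 * monom d k'" "f2 * monom 1 l = f1 * monom e k"
proof -
  have uz: "cpoly (u_poly c1 c2 f1 f2 n) z = cpoly c1 z * cpoly f1 z ^ n + cpoly c2 z * cpoly f2 z ^ n"
    for n z by (simp add: u_poly_def)
  have 1: "infinite {z. root_of_unity z \<and> (\<exists>n\<ge>N. cpoly f2 z ^ n * cpoly c2 z = cpoly f1 z ^ n * cpoly (- c1) z)}"
    for N
  proof -
    \<comment> \<open>Each non-zero \<open>u_poly\<close> has finitely many zeros, so discarding the
      indices below \<open>N\<close> costs only a finite set.\<close>
    define F where "F = (\<Union>n\<in>{n. n < N \<and> u_poly c1 c2 f1 f2 n \<noteq> 0}. {z. cpoly (u_poly c1 c2 f1 f2 n) z = 0})"
    have "finite F" unfolding F_def by (intro finite_UN_I finite_cpoly_roots) auto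
    hence "infinite (?S - F)" using inf by (intro Diff_infinite_finite)
    moreover have "?S - F \<subseteq> {z. root_of_unity z \<and>
        (\<exists>n\<ge>N. cpoly f2 z ^ n * cpoly c2 z = cpoly f1 z ^ n * cpoly (- c1) z)}"
    proof
      fix z assume z: "z \<in> ?S - F"
      then obtain n where n: "root_of_unity z" "u_poly c1 c2 f1 f2 n \<noteq> 0" "cpoly (u_poly c1 c2 f1 f2 n) z = 0"
        by blast
      hence "n \<ge> N" using z by (auto simp: F_def not_less[symmetric])
      moreover have "cpoly f2 z ^ n * cpoly c2 z = cpoly f1 z ^ n * cpoly (- c1) z"
        using n(3) unfolding uz by (simp add: eq_neg_iff_add_eq_0 algebra_simps)
      ultimately show "z \<in> {z. root_of_unity z \<and>
        (\<exists>n\<ge>N. cpoly f2 z ^ n * cpoly c2 z = cpoly f1 z ^ n * cpoly (- c1) z)}" using n(1) by blast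
    qed
    ultimately show ?thesis using infinite_super by blast
  qed
  have "- c1 \<noteq> 0" using nz by simp
  then obtain e k l where e: "e \<in> {1, -1}" and f: "f2 * monom 1 l = f1 * monom e k"
    by (rule ratio_eq_monomial[OF nz(3,4) _ nz(2) 1])
  have e2: "of_rat e ^ 2 = (1 :: complex)" using e by (auto simp: of_rat_minus)
  have 2: "infinite {z. root_of_unity z \<and> (\<exists>n\<ge>N. cpoly c2 z ^ n * cpoly 1 z = cpoly c1 z ^ n * cpoly 1 z)}"
    for N
  proof -
    have "infinite (?S - {z. cpoly f1 z = 0})"
      using inf nz by (intro Diff_infinite_finite finite_cpoly_roots)
    moreover have "?S - {z. cpoly f1 z = 0} \<subseteq> {z. root_of_unity z \<and>
        (\<exists>n\<ge>N. cpoly c2 z ^ n * cpoly 1 z = cpoly c1 z ^ n * cpoly 1 z)}"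
    proof
      fix z assume z: "z \<in> ?S - {z. cpoly f1 z = 0}"
      then obtain n where n: "root_of_unity z" "cpoly (u_poly c1 c2 f1 f2 n) z = 0" by blast
      from n(1) obtain m where m: "m > 0" "z ^ m = 1" unfolding root_of_unity_def by blast
      have fz: "cpoly f2 z * z ^ l = cpoly f1 z * (of_rat e * z ^ k)"
        using arg_cong[OF f, of "\<lambda>p. cpoly p z"] by simp
      have "cpoly c2 z * (cpoly f2 z * z ^ l) ^ n + cpoly c1 z * (cpoly f1 z * z ^ l) ^ n =
          (cpoly c1 z * cpoly f1 z ^ n + cpoly c2 z * cpoly f2 z ^ n) * (z ^ l) ^ n"
        by (simp only: power_mult_distrib algebra_simps)
      hence "cpoly c2 z * (cpoly f2 z * z ^ l) ^ n = - (cpoly c1 z * (cpoly f1 z * z ^ l) ^ n)"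
        using n(2) unfolding uz by (simp only: mult_zero_left eq_neg_iff_add_eq_0)
      hence "cpoly f1 z ^ n * (cpoly c2 z * (of_rat e * z ^ k) ^ n) =
          cpoly f1 z ^ n * (- (cpoly c1 z * (z ^ l) ^ n))"
        unfolding fz by (simp only: power_mult_distrib mult_ac mult_minus_right)
      hence eq: "cpoly c2 z * (of_rat e * z ^ k) ^ n = - (cpoly c1 z * (z ^ l) ^ n)"
        using z by (subst (asm) mult_cancel_left) auto
      \<comment> \<open>The factor \<open>m\<close> removes all powers of \<open>z\<close>, the
        factor 2 all signs, and the factor \<open>N\<close> makes the exponent as large as
        required.\<close>
      define q where "q = 2 * m * N"
      have pc: "(x ^ i) ^ j = (x ^ j) ^ i" for x :: complex and i j
        by (simp add: mult.commute flip: power_mult)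
      have zq: "z ^ q = 1" and eq1: "of_rat e ^ q = (1 :: complex)" and sq: "(-1) ^ q = (1 :: complex)"
        using m e2 by (simp_all add: q_def power_mult pc[of z 2 m])
      have "(cpoly c2 z * (of_rat e * z ^ k) ^ n) ^ q = cpoly c2 z ^ q"
        using zq eq1 by (simp add: power_mult_distrib pc[of _ _ q])
      moreover have "(- (cpoly c1 z * (z ^ l) ^ n)) ^ q = cpoly c1 z ^ q"
        using zq sq by (subst power_minus) (simp add: power_mult_distrib pc[of _ _ q])
      ultimately have "cpoly c2 z ^ q * cpoly 1 z = cpoly c1 z ^ q * cpoly 1 z"
        using eq by simp
      moreover have "q \<ge> N" using m by (simp add: q_def)
      ultimately show "z \<in> {z. root_of_unity z \<and>
        (\<exists>n\<ge>N. cpoly c2 z ^ n * cpoly 1 z = cpoly c1 z ^ n * cpoly 1 z)}" using n(1) by blast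
    qed
    ultimately show ?thesis using infinite_super by blast
  qed
  obtain d k' l' where d: "d \<in> {1, -1}" and c: "c2 * monom 1 l' = c1 * monom d k'"
    by (rule ratio_eq_monomial[OF nz(1,2) _ _ 2]) auto
  have "k \<noteq> l"
  proof
    assume kl: "k = l"
    have mon: "monom e l = [:e:] * monom 1 l" by (simp add: smult_monom)
    have "f2 * monom 1 l = (f1 * [:e:]) * monom 1 l" unfolding f kl mon by (simp only: mult.assoc)
    moreover have "monom (1 :: rat) l \<noteq> 0" by (simp add: monom_eq_0_iff)
    ultimately have f2: "f2 = f1 * [:e:]" by (meson mult_right_cancel)
    \<comment> \<open>Since \<open>e ^ n * d\<close> is a sign, \<open>u_poly c1 c2 f1 f2 n\<close>
      times a power of \<open>x\<close> is \<open>f1 ^ n * c1\<close> times one of just two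
      polynomials \<open>Q\<close>, so all its zeros, over all admissible \<open>n\<close>, lie in
      the finite set \<open>F\<close>.\<close>
    define Q :: "rat \<Rightarrow> rat poly" where "Q = (\<lambda>s. monom 1 l' + monom s k')"
    define F where "F = {z. cpoly f1 z = 0} \<union> {z. cpoly c1 z = 0} \<union>
       (\<Union>s\<in>{s\<in>{1,-1}. Q s \<noteq> 0}. {z. cpoly (Q s) z = 0})"
    have "finite F" unfolding F_def using nz by (intro finite_UnI finite_UN_I finite_cpoly_roots) auto
    have "?S \<subseteq> F"
    proof
      fix z assume "z \<in> ?S"
      then obtain n where n: "u_poly c1 c2 f1 f2 n \<noteq> 0" "cpoly (u_poly c1 c2 f1 f2 n) z = 0" by blast
      have "u_poly c1 c2 f1 f2 n * monom 1 l' =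
          f1 ^ n * (c1 * monom 1 l' + [:e:] ^ n * (c2 * monom 1 l'))"
        unfolding u_poly_def f2 power_mult_distrib by (simp only: algebra_simps)
      also have "\<dots> = f1 ^ n * c1 * (monom 1 l' + [:e ^ n:] * monom d k')"
        unfolding c poly_const_pow by (simp only: algebra_simps)
      also have "[:e ^ n:] * monom d k' = monom (e ^ n * d) k'" by (simp add: smult_monom)
      finally have uQ: "u_poly c1 c2 f1 f2 n * monom 1 l' = f1 ^ n * c1 * Q (e ^ n * d)"
        by (simp add: Q_def)
      have "Q (e ^ n * d) \<noteq> 0"
      proof
        assume "Q (e ^ n * d) = 0"
        hence "u_poly c1 c2 f1 f2 n * monom 1 l' = 0" using uQ by simp
        thus False using n(1) by simp
      qed
      moreover have "e ^ n * d \<in> {1, -1}" using d e by (cases "even n") auto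
      moreover have "cpoly f1 z = 0 \<or> cpoly c1 z = 0 \<or> cpoly (Q (e ^ n * d)) z = 0"
        using arg_cong[OF uQ, of "\<lambda>p. cpoly p z"] n(2) by auto
      ultimately show "z \<in> F" unfolding F_def by blast
    qed
    with \<open>finite F\<close> inf show False using finite_subset by blast
  qed
  thus ?thesis using that d e c f by blast
qed

theorem theorem1p2:
  fixes c1 c2 f1 f2 :: "rat poly"
  assumes "c1 \<noteq> 0" and "c2 \<noteq> 0" and "f1 \<noteq> 0" and "f2 \<noteq> 0"
  shows "infinite {\<zeta>::complex. root_of_unity \<zeta> \<and>
            (\<exists>n::nat. n > 0 \<and> u_poly c1 c2 f1 f2 n \<noteq> 0 \<and> cpoly (u_poly c1 c2 f1 f2 n) \<zeta> = 0)}
     \<longleftrightarrow>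
         (\<exists>(a::int) (b::int). b \<noteq> 0 \<and>
            (\<exists>\<delta> \<in> {1, -1}. \<exists>\<epsilon> \<in> {1, -1}.
               to_fract c2 / to_fract c1 = \<delta> * rat_fun_X powi a \<and>
               to_fract f2 / to_fract f1 = \<epsilon> * rat_fun_X powi b))"
    (is "infinite ?S \<longleftrightarrow> ?R")
proof
  have sign: "to_fract [:d:] \<in> {1, -1 :: rat poly fract}" if "d \<in> {1, -1}" for d :: rat
  proof -
    have "[:-1:] = (-1 :: rat poly)" by (simp add: one_pCons)
    thus ?thesis using that by (auto simp flip: one_pCons)
  qed
  assume "infinite ?S"
  then obtain d e k l k' l' where d: "d \<in> {1, -1}" "e \<in> {1, -1}" "k \<noteq> l"
    "c2 * monom 1 l' = c1 * monom d k'" "f2 * monom 1 l = f1 * monom e k"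
    by (rule monomial_ratios_if_infinite_zeros[OF assms])
  have "to_fract c2 / to_fract c1 = to_fract [:d:] * rat_fun_X powi (int k' - int l')"
    using fract_eq_monomial_iff[OF assms(1)] d(4) by blast
  moreover have "to_fract f2 / to_fract f1 = to_fract [:e:] * rat_fun_X powi (int k - int l)"
    using fract_eq_monomial_iff[OF assms(3)] d(5) by blast
  moreover have "int k - int l \<noteq> 0" using d(3) by simp
  ultimately show ?R using sign[OF d(1)] sign[OF d(2)] by blast
next
  have sign: "\<exists>d\<in>{1, -1}. x = to_fract [:d:]" if "x \<in> {1, -1}" for x :: "rat poly fract"
  proof -
    have "[:-1:] = (-1 :: rat poly)" by (simp add: one_pCons)
    thus ?thesis using that by (auto simp flip: one_pCons)
  qed
  assume ?R
  then obtain a b x y where ab: "b \<noteq> 0" "x \<in> {1, -1}" "y \<in> {1, -1}"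
    "to_fract c2 / to_fract c1 = x * rat_fun_X powi a" "to_fract f2 / to_fract f1 = y * rat_fun_X powi b"
    by (elim exE conjE bexE)
  from sign[OF ab(2)] obtain d where d: "d \<in> {1, -1}" "x = to_fract [:d:]" ..
  from sign[OF ab(3)] obtain e where e: "e \<in> {1, -1}" "y = to_fract [:e:]" ..
  show "infinite ?S"
    by (rule infinite_zeros_if_monomial_ratios[OF assms(1,3) ab(1) d(1) e(1) ab(4)[unfolded d(2)] ab(5)[unfolded e(2)]])
qed

end
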